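(* Let $k\in\mathbb{N}_0$ and let $\lambda^{(0)}\in\sigma_{\mathrm{odd}}(\mathcal{D})$. Then any Neumann eigenfunction on $\mathcal{D}$ corresponding to the eigenvalue $2^k\lambda^{(0)}$ vanishes on the $k$-frame $S^{(k)}$.
   Context: $\mathbb{N}_0=\mathbb{N}\cup\{0\}$. $\mathcal{D}=\{(x,y)\in[0,\pi]^2 : y\le x\}$ is the isosceles right triangle, considered with the Neumann Laplacian $-\Delta$ (on its interior; eigenfunctions are extended to the closed triangle). Let $\mathcal{Q}=\{(m,n)\in\mathbb{N}_0\times\mathbb{N}_0 : m\ge n\}$. The eigenfunctions $\varphi_{m,n}(x,y)=\cos(mx)\cos(ny)+\cos(my)\cos(nx)$, $(m,n)\in\mathcal{Q}$, form a complete orthogonal basis, with eigenvalues $\lambda_{m,n}=m^2+n^2$. Let $\mathcal{O}=\{(m,n)\in\mathcal{Q} : m\not\equiv n \pmod 2\}$ and $\sigma_{\mathrm{odd}}(\mathcal{D})=\{\lambda_{m,n} : (m,n)\in\mathcal{O}\}$. Let $\mathrm{L}=\{(x,y)\in\mathcal{D} : x+y=\pi\}$, $R(x,y)=(\pi-y,\pi-x)$, $\frac12\mathcal{D}=\{(x,y)\in\mathcal{D} : (x+y,x-y)\in[0,\pi]^2\}$, and $F:\frac12\mathcal{D}\to\mathcal{D}$, $F(x,y)=(x+y,x-y)$. For $A\subseteq\mathcal{D}$ the unfold of $A$ is $$U(A)=\{(x,y)\in\tfrac12\mathcal{D} : F(x,y)\in A\}\cup\{(x,y)\in\mathcal{D}\setminus\tfrac12\mathcal{D}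 : F(R(x,y))\in A\}.$$ The $k$-frame is $S^{(0)}=\mathrm{L}$ and $S^{(k)}=U^k(\mathrm{L})$ for $k\ge1$ ($U$ applied $k$ times). *)

theory Defs
  imports "HOL-Analysis.Analysis"
begin

section \<open>Sobolev space of order one\<close>

text \<open>\<open>Ck k f\<close>: all partial derivatives of \<open>f\<close> up to order \<open>k\<close> exist and are continuous.\<close>

primrec Ck :: "nat \<Rightarrow> ('a::euclidean_space \<Rightarrow> real) \<Rightarrow> bool" where
  "Ck 0 f \<longleftrightarrow> continuous_on UNIV f"
| "Ck (Suc k) f \<longleftrightarrow> (\<exists>df. (\<forall>x. GDERIV f x :> df x) \<and> (\<forall>b\<in>Basis. Ck k (\<lambda>x. df x \<bullet> b)))"

definition test_function :: "'a::euclidean_space set \<Rightarrow> ('a \<Rightarrow> real) \<Rightarrow> bool" where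
  "test_function \<Omega> \<psi> \<longleftrightarrow> (\<forall>k. Ck k \<psi>) \<and>
     compact (closure {x. \<psi> x \<noteq> 0}) \<and> closure {x. \<psi> x \<noteq> 0} \<subseteq> \<Omega>"

definition square_integrable_on ::
    "('a::euclidean_space \<Rightarrow> 'b::euclidean_space) \<Rightarrow> 'a set \<Rightarrow> bool" where
  "square_integrable_on f \<Omega> \<longleftrightarrow> f \<in> borel_measurable (lebesgue_on \<Omega>) \<and>
     integrable (lebesgue_on \<Omega>) (\<lambda>x. (norm (f x))\<^sup>2)"

text \<open>\<open>H1_grad \<Omega> u g\<close>: the function \<open>u\<close> belongs to \<open>H\<^sup>1(\<Omega>)\<close>, and \<open>g\<close> is
  (a representative of) its weak gradient.  Intended for open \<open>\<Omega>\<close>.\<close>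

definition H1_grad ::
    "'a::euclidean_space set \<Rightarrow> ('a \<Rightarrow> real) \<Rightarrow> ('a \<Rightarrow> 'a) \<Rightarrow> bool" where
  "H1_grad \<Omega> u g \<longleftrightarrow> square_integrable_on u \<Omega> \<and> square_integrable_on g \<Omega> \<and>
     (\<forall>\<psi> d\<psi>. test_function \<Omega> \<psi> \<longrightarrow> (\<forall>x. GDERIV \<psi> x :> d\<psi> x) \<longrightarrow>
        (LINT x|lebesgue_on \<Omega>. u x *\<^sub>R d\<psi> x) = - (LINT x|lebesgue_on \<Omega>. \<psi> x *\<^sub>R g x))"

section \<open>The Neumann Laplacian on the triangle\<close>

definition triangle :: "(real \<times> real) set" where
  "triangle = {(x, y). x \<in> {0..pi} \<and> y \<in> {0..pi} \<and> y \<le> x}"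

text \<open>The Neumann Laplacian on the interior of the triangle is the self-adjoint operator of the
  form \<open>\<integral> \<nabla>u \<bullet> \<nabla>v\<close> with form domain \<open>H\<^sup>1\<close>: thus \<open>u\<close> lies in its domain with
  \<open>-\<Delta>u = \<mu>u\<close> iff \<open>u \<in> H\<^sup>1\<close> and \<open>\<integral> \<nabla>u \<bullet> \<nabla>v = \<mu> \<integral> u v\<close> for all \<open>v \<in> H\<^sup>1\<close>;
  the boundary condition is the natural one.  Among the representatives of an eigenfunction we
  take the one continuous up to the boundary, which has values on the closed triangle.\<close>

definition neumann_eigenfunction :: "real \<Rightarrow> (real \<times> real \<Rightarrow> real) \<Rightarrow> bool" where
  "neumann_eigenfunction \<mu> u \<longleftrightarrow> continuous_on triangle u \<and> (\<exists>z\<in>triangle. u z \<noteq> 0) \<and>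
     (\<exists>g. H1_grad (interior triangle) u g \<and>
        (\<forall>v h. H1_grad (interior triangle) v h \<longrightarrow>
           (LINT z|lebesgue_on (interior triangle). g z \<bullet> h z) =
           \<mu> * (LINT z|lebesgue_on (interior triangle). u z * v z)))"

definition eig :: "nat \<Rightarrow> nat \<Rightarrow> real" where
  "eig m n = real m ^ 2 + real n ^ 2"

definition Q_index :: "(nat \<times> nat) set" where
  "Q_index = {(m, n). m \<ge> n}"

definition O_index :: "(nat \<times> nat) set" where
  "O_index = {(m, n). (m, n) \<in> Q_index \<and> m mod 2 \<noteq> n mod 2}"

definition sigma_odd :: "real set" where
  "sigma_odd = {eig m n | m n. (m, n) \<in> O_index}"

section \<open>Frames\<close>

definition L_set :: "(real \<times> real) set" where
  "L_set = {(x, y). (x, y) \<in> triangle \<and> x + y = pi}"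

definition R_map :: "real \<times> real \<Rightarrow> real \<times> real" where
  "R_map = (\<lambda>(x, y). (pi - y, pi - x))"

definition half_triangle :: "(real \<times> real) set" where
  "half_triangle = {(x, y). (x, y) \<in> triangle \<and> x + y \<in> {0..pi} \<and> x - y \<in> {0..pi}}"

definition F_map :: "real \<times> real \<Rightarrow> real \<times> real" where
  "F_map = (\<lambda>(x, y). (x + y, x - y))"

definition unfold :: "(real \<times> real) set \<Rightarrow> (real \<times> real) set" where
  "unfold A = {z \<in> half_triangle. F_map z \<in> A} \<union>
              {z \<in> triangle - half_triangle. F_map (R_map z) \<in> A}"

definition frame :: "nat \<Rightarrow> (real \<times> real) set" where
  "frame k = (unfold ^^ k) L_set"

end

theory Submission
  imports Defs
begin

text \<open>Green's formula turns the weak eigenvalue equation for \<open>u\<close> into orthogonality of \<open>u\<close> to every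
  \<open>\<phi>\<^sub>m\<^sub>n\<close> with \<open>m\<^sup>2 + n\<^sup>2 \<noteq> \<mu>\<close>. Together with completeness of the \<open>\<phi>\<^sub>m\<^sub>n\<close> (Stone--Weierstrass) and the
  rule \<open>\<phi>\<^sub>m\<^sub>n \<circ> R = (-1)\<^sup>m\<^sup>+\<^sup>n \<phi>\<^sub>m\<^sub>n\<close> this yields \<open>u \<circ> R = (-1)\<^sup>\<mu> u\<close> for integral \<open>\<mu>\<close>. If \<open>\<mu>\<close> is odd, \<open>u\<close>
  vanishes on the fixed line of \<open>R\<close>, the \<open>0\<close>-frame. If \<open>\<mu>\<close> is even, \<open>u\<close> is determined by its
  restriction to the half triangle; since \<open>\<phi>\<^sub>m\<^sub>n \<circ> F = \<phi>\<^sub>p\<^sub>q\<close> with \<open>p = m + n\<close>, \<open>q = m - n\<close> and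
  \<open>p\<^sup>2 + q\<^sup>2 = 2 (m\<^sup>2 + n\<^sup>2)\<close>, the function \<open>u \<circ> F\<^sup>-\<^sup>1\<close> is orthogonal in the same sense with \<open>\<mu> / 2\<close> in
  place of \<open>\<mu>\<close>, and induction on \<open>k\<close> applies.\<close>

section \<open>Smooth functions\<close>

lemma Ck_SucD: "Ck (Suc k) f \<Longrightarrow> Ck k f"
proof (induction k arbitrary: f)
  case 0
  then obtain df where "\<forall>x. GDERIV f x :> df x" by auto
  then show ?case
    by (auto simp: gderiv_def intro!: continuous_at_imp_continuous_on has_derivative_continuous)
next
  case (Suc k)
  then show ?case by (metis Ck.simps(2))
qed

lemma Ck_const: "Ck k (\<lambda>x. c)"
proof (induction k arbitrary: c)
  case (Suc k)
  have "GDERIV (\<lambda>x. c) x :> 0" for x :: 'a by (simp add: GDERIV_const)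
  with Suc show ?case by (auto intro!: exI[of _ "\<lambda>x. 0"])
qed auto

lemma Ck_add: "Ck k f \<Longrightarrow> Ck k g \<Longrightarrow> Ck k (\<lambda>x. f x + g x)"
proof (induction k arbitrary: f g)
  case 0
  then show ?case by (simp add: continuous_on_add)
next
  case (Suc k)
  then obtain df dg where *: "\<forall>x. GDERIV f x :> df x" "\<forall>b\<in>Basis. Ck k (\<lambda>x. df x \<bullet> b)"
    "\<forall>x. GDERIV g x :> dg x" "\<forall>b\<in>Basis. Ck k (\<lambda>x. dg x \<bullet> b)" by auto
  then show ?case
    using Suc.IH by (auto intro!: exI[of _ "\<lambda>x. df x + dg x"] GDERIV_add simp: inner_add_left)
qed

lemma Ck_mult: "Ck k f \<Longrightarrow> Ck k g \<Longrightarrow> Ck k (\<lambda>x. f x * g x)"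
proof (induction k arbitrary: f g)
  case 0
  then show ?case by (simp add: continuous_on_mult)
next
  case (Suc k)
  then obtain df dg where *: "\<forall>x. GDERIV f x :> df x" "\<forall>b\<in>Basis. Ck k (\<lambda>x. df x \<bullet> b)"
    "\<forall>x. GDERIV g x :> dg x" "\<forall>b\<in>Basis. Ck k (\<lambda>x. dg x \<bullet> b)" by auto
  have "Ck k f" "Ck k g" using Suc.prems by (auto dest: Ck_SucD simp del: Ck.simps)
  with * show ?case
    using Suc.IH
    by (auto intro!: exI[of _ "\<lambda>x. f x *\<^sub>R dg x + g x *\<^sub>R df x"] GDERIV_mult Ck_add
        simp: inner_add_left)
qed

lemma GDERIV_affine:
  assumes "(f has_real_derivative D) (at (a \<bullet> x + b))"
  shows "GDERIV (\<lambda>x. f (a \<bullet> x + b)) x :> D *\<^sub>R a"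
proof -
  have "((\<lambda>x. a \<bullet> x + b) has_derivative (\<lambda>h. a \<bullet> h)) (at x)"
    by (auto intro!: derivative_eq_intros)
  from has_derivative_compose[OF this assms[unfolded has_field_derivative_def]]
  show ?thesis by (simp add: gderiv_def inner_commute mult.commute)
qed

text \<open>The gradient of a function of \<open>a \<bullet> x + b\<close> has components that are
  constant multiples of a function of the same kind, with \<open>G (Suc j)\<close> in place of
  \<open>G j\<close>. Induction on \<open>k\<close> with \<open>j\<close> arbitrary therefore
  closes; it serves both the trigonometric functions and \<open>flat\<close>.\<close>

lemma Ck_affine:
  assumes "\<And>j t. (G j has_real_derivative G (Suc j) t) (at t)"
  shows "Ck k (\<lambda>x. G j (a \<bullet> x + b))"
proof (induction k arbitrary: j)
  case 0
  have "continuous_on UNIV (G j)"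
    using assms by (meson DERIV_continuous continuous_at_imp_continuous_on)
  then have "continuous_on UNIV (G j \<circ> (\<lambda>x. a \<bullet> x + b))"
    by (intro continuous_on_compose continuous_intros) (auto intro: continuous_on_subset)
  then show ?case by (simp add: o_def)
next
  case (Suc k)
  have "\<forall>x. GDERIV (\<lambda>x. G j (a \<bullet> x + b)) x :> G (Suc j) (a \<bullet> x + b) *\<^sub>R a"
    by (intro allI GDERIV_affine assms)
  then show ?case using Suc
    by (auto intro!: exI[of _ "\<lambda>x. G (Suc j) (a \<bullet> x + b) *\<^sub>R a"] Ck_mult Ck_const)
qed

lemma Ck_cos: "Ck k (\<lambda>x. cos (a \<bullet> x + b))"
proof -
  \<comment> \<open>Each differentiation of the cosine shifts its phase by pi/2.\<close>
  have "((\<lambda>t. cos (t + real j * (pi / 2))) has_real_derivative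
      cos (t + real (Suc j) * (pi / 2))) (at t)" for j t
  proof -
    have "cos (t + real (Suc j) * (pi / 2)) = cos ((t + real j * (pi / 2)) + pi / 2)"
      by (simp add: field_simps)
    also have "\<dots> = - sin (t + real j * (pi / 2))"
      by (simp only: cos_add cos_pi_half sin_pi_half)
    finally show ?thesis by (auto intro!: derivative_eq_intros)
  qed
  from Ck_affine[of "\<lambda>j t. cos (t + real j * (pi / 2))", OF this, where j = 0 and a = a and b = b]
  show ?thesis by simp
qed

lemma Ck_sin: "Ck k (\<lambda>x. sin (a \<bullet> x + b))"
proof -
  have "sin (a \<bullet> x + b) = cos (a \<bullet> x + (b - pi / 2))" for x :: 'a
    by (simp add: cos_diff add_diff_eq)
  then show ?thesis using Ck_cos[of k a "b - pi / 2"] by simp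
qed

text \<open>With s = 1/t one has ds/dt = -s^2, so p(s) exp(-s) has the t-derivative s^2 (p(s) -
  p'(s)) exp(-s); this is the recursion.\<close>

primrec flat_poly :: "nat \<Rightarrow> real poly" where
  "flat_poly 0 = 1"
| "flat_poly (Suc j) = [:0, 0, 1:] * (flat_poly j - pderiv (flat_poly j))"

text \<open>The \<open>j\<close>-th derivative of the function equal to \<open>exp (- 1 / t)\<close> for \<open>t > 0\<close> and to \<open>0\<close>
  for \<open>t \<le> 0\<close>.\<close>

definition flat :: "nat \<Rightarrow> real \<Rightarrow> real" where
  "flat j t = (if t > 0 then poly (flat_poly j) (inverse t) * exp (- inverse t) else 0)"

lemma poly_mult_exp_minus_tendsto_0:
  fixes p :: "real poly"
  shows "((\<lambda>s. poly p s * exp (- s)) \<longlongrightarrow> 0) at_top"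
proof -
  have "((\<lambda>s. \<Sum>i\<le>degree p. coeff p i * (s ^ i / exp s)) \<longlongrightarrow> (\<Sum>i\<le>degree p. coeff p i * 0)) at_top"
    by (intro tendsto_sum tendsto_mult tendsto_const tendsto_power_div_exp_0)
  then show ?thesis
    by (simp add: poly_altdef sum_distrib_right exp_minus divide_inverse mult.assoc)
qed

lemma flat_has_derivative: "(flat j has_real_derivative flat (Suc j) t) (at t)"
proof -
  consider "t > 0" | "t < 0" | "t = 0" by linarith
  then show ?thesis
  proof cases
    case 1
    have "((\<lambda>t. poly (flat_poly j) (inverse t) * exp (- inverse t)) has_real_derivative
        flat (Suc j) t) (at t)"
      using 1 by (auto intro!: derivative_eq_intros simp: flat_def field_simps power2_eq_square)
    then show ?thesis
      by (rule has_field_derivative_transform_within_open[where S = "{0<..}"])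
         (use 1 in \<open>auto simp: flat_def\<close>)
  next
    case 2
    have "((\<lambda>t. 0) has_real_derivative flat (Suc j) t) (at t)"
      using 2 by (simp add: flat_def)
    then show ?thesis
      by (rule has_field_derivative_transform_within_open[where S = "{..<0}"])
         (use 2 in \<open>auto simp: flat_def\<close>)
  next
    case 3
    have "((\<lambda>h. flat j h / h) \<longlongrightarrow> 0) (at_left 0)"
      by (rule tendsto_eventually) (auto simp: flat_def eventually_at_filter)
    \<comment> \<open>Division by h is multiplication by s = 1/h, so the difference quotient is
      again a polynomial in s times exp(-s); the factor \<open>[:0, 1:]\<close> records
      this.\<close>
    moreover have "((\<lambda>h. flat j h / h) \<longlongrightarrow> 0) (at_right 0)"
    proof (rule Lim_transform_eventually)
      show "((\<lambda>h. poly ([:0, 1:] * flat_poly j) (inverse h) * exp (- inverse h)) \<longlongrightarrow> 0)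
          (at_right 0)"
        using filterlim_compose[OF poly_mult_exp_minus_tendsto_0 filterlim_inverse_at_top_right] .
      show "\<forall>\<^sub>F h in at_right 0. poly ([:0, 1:] * flat_poly j) (inverse h) * exp (- inverse h) =
          flat j h / h"
        by (auto simp: flat_def eventually_at_filter divide_inverse)
    qed
    ultimately have "((\<lambda>h. flat j h / h) \<longlongrightarrow> 0) (at 0)"
      by (rule filterlim_split_at)
    then show ?thesis using 3 by (simp add: DERIV_def flat_def)
  qed
qed

lemma flat_0_bounds: "0 \<le> flat 0 t" "flat 0 t \<le> 1"
  by (auto simp: flat_def)

text \<open>With s = N l - 1 the left-hand side is l times the absolute value of the derivative of
  \<open>flat 0 (N * l - 1)\<close> in l. The first bound makes it tend to 0 as N grows, the second
  bounds it uniformly in N. Both come from the value (r + r^2) exp(-r), where r = 1/s.\<close>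

lemma flat_1_bound:
  assumes "s > 0"
  shows "(s + 1) * \<bar>flat 1 s\<bar> \<le> inverse s + (inverse s)\<^sup>2" "(s + 1) * \<bar>flat 1 s\<bar> \<le> 2"
proof -
  define r where "r = inverse s"
  have r: "r > 0" "s * r = 1" using assms by (auto simp: r_def)
  have e: "(s + 1) * \<bar>flat 1 s\<bar> = (r + r\<^sup>2) * exp (- r)"
  proof -
    have "(s + 1) * \<bar>flat 1 s\<bar> = (s * r * r + r * r) * exp (- r)"
      using assms r by (simp add: flat_def r_def[symmetric] abs_mult algebra_simps)
    then show ?thesis using r by (simp add: power2_eq_square)
  qed
  have "exp (- r) \<le> 1" using r by simp
  then show "(s + 1) * \<bar>flat 1 s\<bar> \<le> inverse s + (inverse s)\<^sup>2"
    unfolding e r_def[symmetric] using r by (auto intro!: mult_left_le)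
  have "r + r\<^sup>2 \<le> 2 * exp r"
    using exp_lower_Taylor_quadratic[of r] r by (simp add: power2_eq_square)
  then show "(s + 1) * \<bar>flat 1 s\<bar> \<le> 2"
    unfolding e by (simp add: exp_minus field_simps)
qed

section \<open>Integrals of compactly supported gradients\<close>

lemma GDERIV_eq_0_outside:
  assumes "GDERIV f x :> D" "closed K" "\<And>y. y \<notin> K \<Longrightarrow> f y = 0" "x \<notin> K"
  shows "D = 0"
proof -
  have "((\<lambda>y. 0::real) has_derivative (\<lambda>h. h \<bullet> D)) (at x)"
    by (rule has_derivative_transform_within_open[OF assms(1)[unfolded gderiv_def], of "- K"])
       (use assms in auto)
  from has_derivative_unique[OF this has_derivative_const] have "D \<bullet> D = 0" by metis
  then show ?thesis by simp
qed

text \<open>Translation invariance makes every difference quotient in direction \<open>b\<close>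
  integrate to 0. The quotients converge to \<open>df x \<bullet> b\<close>, and the Lipschitz bound
  on \<open>f\<close> allows dominated convergence.\<close>

lemma integral_gradient_eq_0:
  fixes f :: "'a::euclidean_space \<Rightarrow> real"
  assumes f: "\<And>x. GDERIV f x :> df x" and cont: "continuous_on UNIV df"
    and K: "compact K" "\<And>x. x \<notin> K \<Longrightarrow> f x = 0"
  shows "(LINT x|lborel. df x \<bullet> b) = 0"
proof -
  have df0: "df x = 0" if "x \<notin> K" for x
    using K that by (intro GDERIV_eq_0_outside[OF f, of K]) (auto intro: compact_imp_closed)
  obtain r where r: "r > 0" "\<And>x. x \<in> K \<Longrightarrow> norm x \<le> r"
    using K(1) bounded_pos[of K] by (auto dest: compact_imp_bounded)
  have "bounded (df ` K)"
    using K(1) cont by (intro compact_imp_bounded compact_continuous_image) (auto intro: continuous_on_subset)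
  then obtain B where B: "B > 0" "\<And>x. x \<in> K \<Longrightarrow> norm (df x) \<le> B"
    unfolding bounded_pos by auto
  have B': "norm (df x) \<le> B" for x using B df0[of x] by (cases "x \<in> K") auto
  have lip: "\<bar>f x - f y\<bar> \<le> B * norm (x - y)" for x y
  proof -
    have "norm (f x - f y) \<le> B * norm (x - y)"
    proof (rule differentiable_bound[where S = UNIV and f' = "\<lambda>x h. h \<bullet> df x"])
      show "onorm (\<lambda>h. h \<bullet> df x) \<le> B" for x
        by (rule onorm_le) (metis B' Cauchy_Schwarz_ineq2 mult.commute mult_right_mono norm_ge_zero order_trans real_norm_def)
    qed (use f in \<open>auto simp: gderiv_def intro: has_derivative_at_withinI\<close>)
    then show ?thesis by simp
  qed
  have fcont: "continuous_on UNIV f"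
    using f by (auto simp: gderiv_def intro!: continuous_at_imp_continuous_on has_derivative_continuous)
  then have [measurable]: "f \<in> borel_measurable borel" by (rule borel_measurable_continuous_onI)
  have [measurable]: "df \<in> borel_measurable borel" using cont by (rule borel_measurable_continuous_onI)
  have fint: "integrable lborel f"
  proof -
    have "integrable lborel (\<lambda>x. indicator K x *\<^sub>R f x)"
      by (rule borel_integrable_compact) (use K fcont in \<open>auto intro: continuous_on_subset\<close>)
    moreover have "(\<lambda>x. indicator K x *\<^sub>R f x) = f"
      using K by (auto simp: fun_eq_iff indicator_def)
    ultimately show ?thesis by simp
  qed
  define t where "t n = inverse (real (Suc n))" for n
  have t: "t n > 0" "t n \<le> 1" for n
    by (auto simp: t_def field_simps)
  have "t \<longlonglongrightarrow> 0"
    using LIMSEQ_inverse_real_of_nat by (simp only: t_def[abs_def])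
  define q where "q n x = (f (x + t n *\<^sub>R b) - f x) / t n" for n x
  have q0: "(LINT x|lborel. q n x) = 0" for n
  proof -
    have "integrable lborel (\<lambda>x. f (x + t n *\<^sub>R b))"
    proof -
      have "integrable (distr lborel borel ((+) (t n *\<^sub>R b))) f"
        using fint by (simp add: lborel_distr_plus)
      then show ?thesis by (simp add: integrable_distr_eq add.commute)
    qed
    moreover have "(LINT x|lborel. f (x + t n *\<^sub>R b)) = (LINT x|lborel. f x)"
    proof -
      have "(LINT x|distr lborel borel ((+) (t n *\<^sub>R b)). f x) = (LINT x|lborel. f x)"
        by (simp add: lborel_distr_plus)
      then show ?thesis by (simp add: integral_distr add.commute)
    qed
    ultimately show ?thesis using fint by (simp add: q_def)
  qed
  have "(\<lambda>n. LINT x|lborel. q n x) \<longlonglongrightarrow> (LINT x|lborel. df x \<bullet> b)"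
  \<comment> \<open>As the steps satisfy \<open>t n \<le> 1\<close>, a quotient can be nonzero only
    within distance \<open>norm b\<close> of \<open>K\<close>; there the Lipschitz constant
    \<open>B\<close> bounds it by \<open>B * norm b\<close>.\<close>
  proof (rule integral_dominated_convergence
      [where w = "\<lambda>x. indicator (cball 0 (r + norm b)) x *\<^sub>R (B * norm b)"])
    show "(\<lambda>x. df x \<bullet> b) \<in> borel_measurable lborel" by measurable
    show "q n \<in> borel_measurable lborel" for n unfolding q_def by measurable
    show "integrable lborel (\<lambda>x. indicator (cball 0 (r + norm b)) x *\<^sub>R (B * norm b))"
      by (rule borel_integrable_compact) auto
    show "AE x in lborel. (\<lambda>n. q n x) \<longlonglongrightarrow> df x \<bullet> b"
    proof (rule AE_I2)
      fix x
      have "((\<lambda>s. f (x + s *\<^sub>R b)) has_derivative (\<lambda>s. (s *\<^sub>R b) \<bullet> df x)) (at 0)"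
        by (rule has_derivative_compose[where g = f and g' = "\<lambda>h. h \<bullet> df x"])
           (use f[of x] in \<open>auto simp: gderiv_def intro!: derivative_eq_intros\<close>)
      then have "((\<lambda>s. f (x + s *\<^sub>R b)) has_real_derivative (df x \<bullet> b)) (at 0)"
        by (simp add: has_field_derivative_def inner_commute mult_commute_abs)
      then have "(\<lambda>s. (f (x + s *\<^sub>R b) - f x) / s) \<midarrow>0\<rightarrow> df x \<bullet> b"
        by (simp add: DERIV_def)
      moreover have "\<forall>n. t n \<noteq> 0" using t(1) by (auto simp: less_imp_neq[symmetric])
      ultimately show "(\<lambda>n. q n x) \<longlonglongrightarrow> df x \<bullet> b"
        using \<open>t \<longlonglongrightarrow> 0\<close> unfolding LIMSEQ_SEQ_conv[symmetric] q_def by blast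
    qed
    show "AE x in lborel. norm (q n x) \<le> indicator (cball 0 (r + norm b)) x *\<^sub>R (B * norm b)" for n
    proof (rule AE_I2)
      fix x
      show "norm (q n x) \<le> indicator (cball 0 (r + norm b)) x *\<^sub>R (B * norm b)"
      proof (cases "norm x \<le> r + norm b")
        case True
        have "\<bar>f (x + t n *\<^sub>R b) - f x\<bar> \<le> B * (t n * norm b)"
          using lip[of "x + t n *\<^sub>R b" x] t(1)[of n] by simp
        then show ?thesis using True t(1)[of n] by (simp add: q_def abs_div field_simps)
      next
        case False
        have "norm (t n *\<^sub>R b) \<le> norm b" using t[of n] by (simp add: mult_left_le_one_le)
        then have "norm (x + t n *\<^sub>R b) > r" using False norm_diff_ineq[of x "t n *\<^sub>R b"] by simp
        then have "x + t n *\<^sub>R b \<notin> K" using r(2) by fastforce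
        moreover have "x \<notin> K" using r(2)[of x] False by (smt (verit) norm_ge_zero)
        ultimately show ?thesis using False K(2) by (simp add: q_def)
      qed
    qed
  qed
  then show ?thesis by (simp add: q0 LIMSEQ_const_iff)
qed

section \<open>Integration over the triangle\<close>

abbreviation \<Omega> :: "(real \<times> real) set" where "\<Omega> \<equiv> interior triangle"

lemma triangle_eq: "triangle = {z. 0 \<le> snd z \<and> snd z \<le> fst z \<and> fst z \<le> pi}"
  by (auto simp: triangle_def)

lemma triangle_halfspaces:
  "triangle = {z. (0, - 1) \<bullet> z \<le> 0} \<inter> {z. (- 1, 1) \<bullet> z \<le> 0} \<inter> {z. (1, 0) \<bullet> z \<le> pi}"
  by (auto simp: triangle_eq inner_prod_def)

lemma interior_triangle: "\<Omega> = {z. 0 < snd z \<and> snd z < fst z \<and> fst z < pi}"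
proof -
  have "\<Omega> = interior {z. (0, - 1) \<bullet> z \<le> 0} \<inter> interior {z. (- 1, 1) \<bullet> z \<le> 0} \<inter>
      interior {z. (1, 0) \<bullet> z \<le> pi}"
    unfolding triangle_halfspaces by (rule trans[OF interior_Int]) (simp only: interior_Int)
  also have "\<dots> = {z. (0, - 1) \<bullet> z < 0} \<inter> {z. (- 1, 1) \<bullet> z < 0} \<inter> {z. (1, 0) \<bullet> z < pi}"
    by (subst interior_halfspace_le, simp add: zero_prod_def)+ simp
  finally show ?thesis by (auto simp: inner_prod_def)
qed

lemma convex_triangle: "convex triangle"
  unfolding triangle_halfspaces by (intro convex_Int convex_halfspace_le)

lemma compact_triangle: "compact triangle"
proof -
  have "triangle = ({0..pi} \<times> {0..pi}) \<inter> {z. snd z \<le> fst z}"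
    by (auto simp: triangle_def)
  moreover have "compact \<dots>"
    by (intro compact_Int_closed compact_Times compact_Icc closed_Collect_le continuous_intros)
  ultimately show ?thesis by (simp only:)
qed

lemma lmeasurable_\<Omega>: "\<Omega> \<in> lmeasurable"
  by (simp add: lmeasurable_interior compact_imp_bounded compact_triangle)

lemma sets_\<Omega>: "\<Omega> \<in> sets lebesgue"
  using lmeasurable_\<Omega> by (rule fmeasurableD)

lemma finite_measure_\<Omega>: "finite_measure (lebesgue_on \<Omega>)"
  using lmeasurable_\<Omega> by (rule finite_measure_lebesgue_on)

lemma measurable_\<Omega>:
  assumes "continuous_on triangle f"
  shows "f \<in> borel_measurable (lebesgue_on \<Omega>)"
  by (rule continuous_imp_measurable_on_sets_lebesgue)
     (use assms interior_subset sets_\<Omega> in \<open>auto intro: continuous_on_subset\<close>)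

lemma bounded_on_triangle:
  fixes f :: "real \<times> real \<Rightarrow> 'b::real_normed_vector"
  assumes "continuous_on triangle f"
  obtains B where "B > 0" "\<And>z. z \<in> \<Omega> \<Longrightarrow> norm (f z) \<le> B"
proof -
  have "bounded (f ` triangle)"
    by (intro compact_imp_bounded compact_continuous_image assms compact_triangle)
  then obtain B where "B > 0" "\<forall>w\<in>f ` triangle. norm w \<le> B"
    unfolding bounded_pos by auto
  then show ?thesis using interior_subset[of triangle] by (intro that[of B]) auto
qed

lemma integrable_\<Omega>:
  fixes f :: "real \<times> real \<Rightarrow> 'b::{banach, second_countable_topology}"
  assumes "continuous_on triangle f"
  shows "integrable (lebesgue_on \<Omega>) f"
proof -
  obtain B where "\<And>z. z \<in> \<Omega> \<Longrightarrow> norm (f z) \<le> B"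
    using bounded_on_triangle[OF assms] by metis
  then have "AE z in lebesgue_on \<Omega>. norm (f z) \<le> B" by (intro AE_I2) simp
  then show ?thesis
    by (intro finite_measure.integrable_const_bound[OF finite_measure_\<Omega>] measurable_\<Omega> assms)
qed

lemma integrable_mult_\<Omega>:
  fixes f :: "real \<times> real \<Rightarrow> real" and g :: "real \<times> real \<Rightarrow> 'b::{banach, second_countable_topology}"
  assumes "continuous_on triangle f" "integrable (lebesgue_on \<Omega>) g"
  shows "integrable (lebesgue_on \<Omega>) (\<lambda>z. f z *\<^sub>R g z)"
proof -
  obtain B where B: "\<And>z. z \<in> \<Omega> \<Longrightarrow> norm (f z) \<le> B"
    using bounded_on_triangle[OF assms(1)] by metis
  have "AE z in lebesgue_on \<Omega>. norm (f z *\<^sub>R g z) \<le> norm (B *\<^sub>R g z)"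
  proof (rule AE_I2)
    fix z assume "z \<in> space (lebesgue_on \<Omega>)"
    then have "\<bar>f z\<bar> \<le> \<bar>B\<bar>" using B[of z] by auto
    then show "norm (f z *\<^sub>R g z) \<le> norm (B *\<^sub>R g z)" by (simp add: mult_right_mono)
  qed
  moreover have "(\<lambda>z. f z *\<^sub>R g z) \<in> borel_measurable (lebesgue_on \<Omega>)"
    by (rule borel_measurable_scaleR[OF measurable_\<Omega>[OF assms(1)] borel_measurable_integrable[OF assms(2)]])
  moreover have "integrable (lebesgue_on \<Omega>) (\<lambda>z. B *\<^sub>R g z)"
    using assms(2) by (rule integrable_scaleR_right)
  ultimately show ?thesis using Bochner_Integration.integrable_bound by blast
qed

lemma square_integrable_\<Omega>:
  fixes f :: "real \<times> real \<Rightarrow> 'b::euclidean_space"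
  assumes "continuous_on triangle f"
  shows "square_integrable_on f \<Omega>"
  unfolding square_integrable_on_def
  by (intro conjI measurable_\<Omega> integrable_\<Omega> continuous_intros assms)

text \<open>The triangle has finite measure, so 1 + |f|^2 is an integrable majorant of |f|.\<close>

lemma square_integrable_imp_integrable_\<Omega>:
  fixes f :: "real \<times> real \<Rightarrow> 'b::euclidean_space"
  assumes "square_integrable_on f \<Omega>"
  shows "integrable (lebesgue_on \<Omega>) f"
proof (rule Bochner_Integration.integrable_bound)
  show "integrable (lebesgue_on \<Omega>) (\<lambda>z. 1 + (norm (f z))\<^sup>2)"
    using assms by (intro Bochner_Integration.integrable_add finite_measure.integrable_const
        finite_measure_\<Omega>) (auto simp: square_integrable_on_def)
  show "f \<in> borel_measurable (lebesgue_on \<Omega>)" using assms by (simp add: square_integrable_on_def)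
  have "t \<le> 1 + t\<^sup>2" for t :: real
    using sum_squares_ge_zero[of "t - 1/2" 0] by (simp add: power2_eq_square algebra_simps)
  then show "AE z in lebesgue_on \<Omega>. norm (f z) \<le> norm (1 + (norm (f z))\<^sup>2)"
    by (intro AE_I2) simp
qed

section \<open>The trigonometric eigenfunctions\<close>

lemma Ck_cos_fst: "Ck k (\<lambda>z::real \<times> real. cos (c * fst z))"
  using Ck_cos[of k "(c, 0)" 0] by (simp add: inner_prod_def)
lemma Ck_cos_snd: "Ck k (\<lambda>z::real \<times> real. cos (c * snd z))"
  using Ck_cos[of k "(0, c)" 0] by (simp add: inner_prod_def)
lemma Ck_sin_fst: "Ck k (\<lambda>z::real \<times> real. sin (c * fst z))"
  using Ck_sin[of k "(c, 0)" 0] by (simp add: inner_prod_def)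
lemma Ck_sin_snd: "Ck k (\<lambda>z::real \<times> real. sin (c * snd z))"
  using Ck_sin[of k "(0, c)" 0] by (simp add: inner_prod_def)

lemmas Ck_trig = Ck_cos_fst Ck_cos_snd Ck_sin_fst Ck_sin_snd

text \<open>Indices are arbitrary integers, so that index sums and differences arising from products
  and from folding stay within the family.\<close>

definition phi :: "int \<Rightarrow> int \<Rightarrow> real \<times> real \<Rightarrow> real" where
  "phi m n z = cos (m * fst z) * cos (n * snd z) + cos (m * snd z) * cos (n * fst z)"

text \<open>The partial derivatives \<open>phi1\<close> and \<open>phi2\<close> are kept as scalar
  functions because, times a cutoff, they become test functions; \<open>dphi1\<close> and
  \<open>dphi2\<close> are the rows of the Hessian.\<close>

definition phi1 :: "int \<Rightarrow> int \<Rightarrow> real \<times> real \<Rightarrow> real" where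
  "phi1 m n z = (- m) * (sin (m * fst z) * cos (n * snd z)) + (- n) * (cos (m * snd z) * sin (n * fst z))"

definition phi2 :: "int \<Rightarrow> int \<Rightarrow> real \<times> real \<Rightarrow> real" where
  "phi2 m n z = (- n) * (cos (m * fst z) * sin (n * snd z)) + (- m) * (sin (m * snd z) * cos (n * fst z))"

definition dphi :: "int \<Rightarrow> int \<Rightarrow> real \<times> real \<Rightarrow> real \<times> real" where
  "dphi m n z = (phi1 m n z, phi2 m n z)"

definition dphi1 :: "int \<Rightarrow> int \<Rightarrow> real \<times> real \<Rightarrow> real \<times> real" where
  "dphi1 m n z =
    (- (m\<^sup>2 * (cos (m * fst z) * cos (n * snd z)) + n\<^sup>2 * (cos (m * snd z) * cos (n * fst z))),
     m * n * (sin (m * fst z) * sin (n * snd z) + sin (m * snd z) * sin (n * fst z)))"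

definition dphi2 :: "int \<Rightarrow> int \<Rightarrow> real \<times> real \<Rightarrow> real \<times> real" where
  "dphi2 m n z =
    (m * n * (sin (m * fst z) * sin (n * snd z) + sin (m * snd z) * sin (n * fst z)),
     - (n\<^sup>2 * (cos (m * fst z) * cos (n * snd z)) + m\<^sup>2 * (cos (m * snd z) * cos (n * fst z))))"

lemma GDERIV_phi: "GDERIV (phi m n) z :> dphi m n z"
  unfolding gderiv_def phi_def[abs_def]
  by (rule has_derivative_eq_rhs, (rule derivative_intros)+)
     (simp add: fun_eq_iff dphi_def phi1_def phi2_def inner_prod_def algebra_simps)

lemma GDERIV_phi1: "GDERIV (phi1 m n) z :> dphi1 m n z"
  unfolding gderiv_def phi1_def[abs_def]
  by (rule has_derivative_eq_rhs, (rule derivative_intros)+)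
     (simp add: fun_eq_iff dphi1_def inner_prod_def algebra_simps power2_eq_square)

lemma GDERIV_phi2: "GDERIV (phi2 m n) z :> dphi2 m n z"
  unfolding gderiv_def phi2_def[abs_def]
  by (rule has_derivative_eq_rhs, (rule derivative_intros)+)
     (simp add: fun_eq_iff dphi2_def inner_prod_def algebra_simps power2_eq_square)

lemma laplace_phi: "fst (dphi1 m n z) + snd (dphi2 m n z) = - (real_of_int m ^ 2 + real_of_int n ^ 2) * phi m n z"
  by (simp add: dphi1_def dphi2_def phi_def algebra_simps)

lemma Ck_phi1: "Ck k (phi1 m n)" and Ck_phi2: "Ck k (phi2 m n)"
  unfolding phi1_def[abs_def] phi2_def[abs_def]
  by (intro Ck_add Ck_mult Ck_const Ck_trig)+

lemma continuous_on_phi: "continuous_on A (phi m n)"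
  and continuous_on_dphi: "continuous_on A (dphi m n)"
  and continuous_on_phi1: "continuous_on A (phi1 m n)"
  and continuous_on_phi2: "continuous_on A (phi2 m n)"
  and continuous_on_dphi1: "continuous_on A (dphi1 m n)"
  and continuous_on_dphi2: "continuous_on A (dphi2 m n)"
  unfolding phi_def[abs_def] phi1_def[abs_def] phi2_def[abs_def] dphi_def[abs_def]
    dphi1_def[abs_def] dphi2_def[abs_def]
  by (intro continuous_intros)+

section \<open>Bounds for the eigenfunctions and their normal derivatives\<close>

lemma abs_phi_le: "\<bar>phi m n z\<bar> \<le> 2"
proof -
  have "\<bar>cos a * cos b\<bar> \<le> 1" for a b :: real
    by (simp add: abs_mult mult_le_one)
  from this[of "m * fst z" "n * snd z"] this[of "m * snd z" "n * fst z"]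
  show ?thesis unfolding phi_def by linarith
qed

lemma abs_sin_diff_le: "\<bar>sin a - sin b\<bar> \<le> \<bar>a - b\<bar>" for a b :: real
proof -
  have "\<bar>sin a - sin b\<bar> = 2 * \<bar>sin ((a - b) / 2)\<bar> * \<bar>cos ((a + b) / 2)\<bar>"
    by (simp add: sin_diff_sin abs_mult)
  also have "\<dots> \<le> 2 * \<bar>(a - b) / 2\<bar> * 1"
    by (intro mult_mono abs_sin_x_le_abs_x) auto
  finally show ?thesis by simp
qed

lemma abs_cos_diff_le: "\<bar>cos a - cos b\<bar> \<le> \<bar>a - b\<bar>" for a b :: real
  using abs_sin_diff_le[of "pi / 2 - a" "pi / 2 - b"] by (simp add: sin_diff)

text \<open>The difference vanishes on the diagonal x = y. Inserting
  \<open>sin (p * y) * cos (q * y)\<close> reduces it to increments of the 1-Lipschitz functions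
  sine and cosine.\<close>

lemma abs_sin_mult_cos_diff_le:
  fixes p q x y :: real
  shows "\<bar>sin (p * x) * cos (q * y) - sin (p * y) * cos (q * x)\<bar> \<le> (\<bar>p\<bar> + \<bar>q\<bar>) * \<bar>x - y\<bar>"
proof -
  have "sin (p * x) * cos (q * y) - sin (p * y) * cos (q * x) =
      (sin (p * x) - sin (p * y)) * cos (q * y) + sin (p * y) * (cos (q * y) - cos (q * x))"
    by (simp add: algebra_simps)
  also have "\<bar>\<dots>\<bar> \<le> \<bar>sin (p * x) - sin (p * y)\<bar> * \<bar>cos (q * y)\<bar> +
      \<bar>sin (p * y)\<bar> * \<bar>cos (q * y) - cos (q * x)\<bar>"
    by (metis abs_mult abs_triangle_ineq)
  also have "\<dots> \<le> \<bar>p * x - p * y\<bar> * 1 + 1 * \<bar>q * y - q * x\<bar>"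
    by (intro add_mono mult_mono abs_sin_diff_le abs_cos_diff_le) auto
  also have "\<dots> = (\<bar>p\<bar> + \<bar>q\<bar>) * \<bar>x - y\<bar>"
  proof -
    have "\<bar>p * x - p * y\<bar> = \<bar>p\<bar> * \<bar>x - y\<bar>" "\<bar>q * y - q * x\<bar> = \<bar>q\<bar> * \<bar>x - y\<bar>"
      by (metis abs_mult right_diff_distrib) (metis abs_minus_commute abs_mult right_diff_distrib)
    then show ?thesis by (simp add: distrib_right)
  qed
  finally show ?thesis .
qed

text \<open>The normal derivative of \<open>phi m n\<close> vanishes on each side of the triangle, hence is
  controlled by the distance to that side.\<close>

definition normal_const :: "int \<Rightarrow> int \<Rightarrow> real" where
  "normal_const m n = (\<bar>real_of_int m\<bar> + \<bar>real_of_int n\<bar>)\<^sup>2"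

lemma normal_const_ge: "real_of_int m ^ 2 + real_of_int n ^ 2 \<le> normal_const m n"
  by (simp add: normal_const_def power2_sum)

lemma abs_phi2_le: "\<bar>phi2 m n z\<bar> \<le> normal_const m n * \<bar>snd z\<bar>"
proof -
  have "\<bar>phi2 m n z\<bar> \<le> \<bar>real_of_int n\<bar> * (\<bar>cos (m * fst z)\<bar> * \<bar>sin (n * snd z)\<bar>) +
      \<bar>real_of_int m\<bar> * (\<bar>sin (m * snd z)\<bar> * \<bar>cos (n * fst z)\<bar>)"
    unfolding phi2_def by (rule order_trans[OF abs_triangle_ineq]) (simp add: abs_mult)
  also have "\<dots> \<le> \<bar>real_of_int n\<bar> * (1 * \<bar>n * snd z\<bar>) + \<bar>real_of_int m\<bar> * (\<bar>m * snd z\<bar> * 1)"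
    by (intro add_mono mult_mono abs_sin_x_le_abs_x) auto
  also have "\<dots> = (real_of_int m ^ 2 + real_of_int n ^ 2) * \<bar>snd z\<bar>"
    by (simp add: abs_mult algebra_simps power2_eq_square)
  also have "\<dots> \<le> normal_const m n * \<bar>snd z\<bar>"
    by (intro mult_right_mono normal_const_ge) auto
  finally show ?thesis .
qed

text \<open>Integrality of \<open>m\<close> gives \<open>sin (m * pi) = 0\<close>, so the sine is
  measured from its zero at pi.\<close>

lemma abs_sin_int_le: "\<bar>sin (real_of_int m * x)\<bar> \<le> \<bar>real_of_int m\<bar> * \<bar>pi - x\<bar>"
proof -
  have "sin (m * pi) = 0" by (simp add: sin_zero_iff_int2)
  then have "\<bar>sin (m * x)\<bar> \<le> \<bar>m * x - m * pi\<bar>" using abs_sin_diff_le[of "m * x" "m * pi"] by simp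
  also have "\<dots> = \<bar>real_of_int m\<bar> * \<bar>pi - x\<bar>" by (metis abs_minus_commute abs_mult right_diff_distrib)
  finally show ?thesis .
qed

lemma abs_phi1_le: "\<bar>phi1 m n z\<bar> \<le> normal_const m n * \<bar>pi - fst z\<bar>"
proof -
  have "\<bar>phi1 m n z\<bar> \<le> \<bar>real_of_int m\<bar> * (\<bar>sin (m * fst z)\<bar> * \<bar>cos (n * snd z)\<bar>) +
      \<bar>real_of_int n\<bar> * (\<bar>cos (m * snd z)\<bar> * \<bar>sin (n * fst z)\<bar>)"
    unfolding phi1_def by (rule order_trans[OF abs_triangle_ineq]) (simp add: abs_mult)
  also have "\<dots> \<le> \<bar>real_of_int m\<bar> * ((\<bar>real_of_int m\<bar> * \<bar>pi - fst z\<bar>) * 1) +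
      \<bar>real_of_int n\<bar> * (1 * (\<bar>real_of_int n\<bar> * \<bar>pi - fst z\<bar>))"
    by (intro add_mono mult_mono abs_sin_int_le) auto
  also have "\<dots> = (real_of_int m ^ 2 + real_of_int n ^ 2) * \<bar>pi - fst z\<bar>"
    by (simp add: abs_mult algebra_simps power2_eq_square)
  also have "\<dots> \<le> normal_const m n * \<bar>pi - fst z\<bar>"
    by (intro mult_right_mono normal_const_ge) auto
  finally show ?thesis .
qed

lemma abs_phi1_minus_phi2_le:
  "\<bar>phi1 m n z - phi2 m n z\<bar> \<le> normal_const m n * \<bar>fst z - snd z\<bar>"
proof -
  let ?d = "\<bar>fst z - snd z\<bar>"
  \<comment> \<open>The terms are grouped so that each bracket changes sign when the two coordinates
    are exchanged.\<close>
  have "phi1 m n z - phi2 m n z =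
      (- m) * (sin (m * fst z) * cos (n * snd z) - sin (m * snd z) * cos (n * fst z)) +
      (- n) * (sin (n * fst z) * cos (m * snd z) - sin (n * snd z) * cos (m * fst z))"
    by (simp add: phi1_def phi2_def algebra_simps)
  also have "\<bar>\<dots>\<bar> \<le> \<bar>real_of_int m\<bar> * \<bar>sin (m * fst z) * cos (n * snd z) - sin (m * snd z) * cos (n * fst z)\<bar> +
      \<bar>real_of_int n\<bar> * \<bar>sin (n * fst z) * cos (m * snd z) - sin (n * snd z) * cos (m * fst z)\<bar>"
    by (rule order_trans[OF abs_triangle_ineq]) (simp add: abs_mult)
  also have "\<dots> \<le> \<bar>real_of_int m\<bar> * ((\<bar>real_of_int m\<bar> + \<bar>real_of_int n\<bar>) * ?d) +
      \<bar>real_of_int n\<bar> * ((\<bar>real_of_int n\<bar> + \<bar>real_of_int m\<bar>) * ?d)"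
    by (intro add_mono mult_left_mono abs_sin_mult_cos_diff_le) auto
  also have "\<dots> = normal_const m n * ?d"
    by (simp add: normal_const_def power2_eq_square algebra_simps)
  finally show ?thesis .
qed

section \<open>Cutoff functions\<close>

text \<open>A smooth transition in a linear form \<open>l\<close> that is positive inside the
  triangle and 0 on one side: it vanishes for N l \<le> 1 and tends to 1 for each fixed l >
  0.\<close>

definition side_factor :: "nat \<Rightarrow> real \<Rightarrow> real" where
  "side_factor N l = flat 0 (real N * l - 1)"

definition side_factor' :: "nat \<Rightarrow> real \<Rightarrow> real" where
  "side_factor' N l = real N * flat 1 (real N * l - 1)"

lemma side_factor_bounds: "0 \<le> side_factor N l" "side_factor N l \<le> 1"
  by (simp_all add: side_factor_def flat_0_bounds)

lemma Ck_side_factor: "Ck k (\<lambda>z. side_factor N (a \<bullet> z + b))"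
proof -
  have "Ck k (\<lambda>z. flat 0 ((real N *\<^sub>R a) \<bullet> z + (real N * b - 1)))"
    by (rule Ck_affine[where G = flat]) (rule flat_has_derivative)
  then show ?thesis by (simp add: side_factor_def algebra_simps)
qed

lemma GDERIV_side_factor:
  "GDERIV (\<lambda>z. side_factor N (a \<bullet> z + b)) z :> side_factor' N (a \<bullet> z + b) *\<^sub>R a"
proof (rule GDERIV_affine)
  show "(side_factor N has_real_derivative side_factor' N (a \<bullet> z + b)) (at (a \<bullet> z + b))"
    unfolding side_factor_def[abs_def] side_factor'_def One_nat_def
    by (rule DERIV_cong[OF DERIV_chain2[OF flat_has_derivative]])
       (auto intro!: derivative_eq_intros)
qed

lemma side_factor_eq_0: "real N * l \<le> 1 \<Longrightarrow> side_factor N l = 0"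
  by (simp add: side_factor_def flat_def)

text \<open>The derivative of the factor may grow like 1/l; a quantity of size O(l) compensates this
  with a constant independent of \<open>N\<close>.\<close>

lemma side_factor'_bound:
  assumes "\<bar>P\<bar> \<le> C * l" "l > 0" "C \<ge> 0"
  shows "\<bar>side_factor' N l * P\<bar> \<le> 2 * C"
proof (cases "real N * l - 1 > 0")
  case True
  have "\<bar>side_factor' N l * P\<bar> \<le> \<bar>side_factor' N l\<bar> * (C * l)"
    using assms by (simp add: abs_mult mult_left_mono)
  also have "\<dots> = C * (((real N * l - 1) + 1) * \<bar>flat 1 (real N * l - 1)\<bar>)"
    by (simp add: side_factor'_def abs_mult)
  also have "\<dots> \<le> C * 2"
    using flat_1_bound(2)[OF True] assms by (intro mult_left_mono) auto
  finally show ?thesis by simp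
next
  case False
  then show ?thesis using assms by (simp add: side_factor'_def flat_def)
qed

lemma inverse_Suc_tendsto_0:
  assumes "l > 0"
  shows "(\<lambda>n. inverse (real (Suc n) * l - 1)) \<longlonglongrightarrow> 0"
proof (rule tendsto_inverse_0_at_top)
  have "filterlim (\<lambda>n. l * real (Suc n)) at_top sequentially"
    using assms filterlim_real_sequentially
    by (intro filterlim_tendsto_pos_mult_at_top[OF tendsto_const] filterlim_compose[OF filterlim_real_sequentially filterlim_Suc])
  then show "filterlim (\<lambda>n. real (Suc n) * l - 1) at_top sequentially"
    using filterlim_tendsto_add_at_top[OF tendsto_const[of "-1"]] by (auto simp: mult.commute)
qed

lemma eventually_Suc_gt:
  assumes "l > 0"
  shows "\<forall>\<^sub>F n in sequentially. real (Suc n) * l - 1 > 0"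
proof -
  obtain n0 where n0: "1 < real n0 * l" using assms reals_Archimedean3 by blast
  have "1 < real (Suc n) * l" if "n \<ge> n0" for n
  proof -
    have "real n0 * l \<le> real (Suc n) * l" using that assms by (intro mult_right_mono) auto
    with n0 show ?thesis by linarith
  qed
  then show ?thesis by (auto simp: eventually_sequentially)
qed

lemma side_factor_tendsto:
  assumes "l > 0"
  shows "(\<lambda>n. side_factor (Suc n) l) \<longlonglongrightarrow> 1"
proof (rule Lim_transform_eventually)
  have "(\<lambda>n. exp (- inverse (real (Suc n) * l - 1))) \<longlonglongrightarrow> exp (- 0)"
    by (intro tendsto_intros inverse_Suc_tendsto_0 assms)
  then show "(\<lambda>n. exp (- inverse (real (Suc n) * l - 1))) \<longlonglongrightarrow> 1" by simp
  show "\<forall>\<^sub>F n in sequentially. exp (- inverse (real (Suc n) * l - 1)) = side_factor (Suc n) l"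
    using eventually_Suc_gt[OF assms] by eventually_elim (simp add: side_factor_def flat_def)
qed

lemma side_factor'_tendsto:
  assumes "l > 0"
  shows "(\<lambda>n. side_factor' (Suc n) l) \<longlonglongrightarrow> 0"
proof -
  define r where "r n = inverse (real (Suc n) * l - 1)" for n
  have "r \<longlonglongrightarrow> 0"
    unfolding r_def[abs_def] by (rule inverse_Suc_tendsto_0[OF assms])
  from tendsto_divide[OF tendsto_add[OF this tendsto_power[OF this, of 2]] tendsto_const[of l]]
  have "(\<lambda>n. (r n + (r n)\<^sup>2) / l) \<longlonglongrightarrow> 0" using assms by simp
  moreover have "\<forall>\<^sub>F n in sequentially. norm (side_factor' (Suc n) l) \<le> (r n + (r n)\<^sup>2) / l"
    using eventually_Suc_gt[OF assms]
  proof eventually_elim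
    case (elim n)
    have "l * \<bar>side_factor' (Suc n) l\<bar> = ((real (Suc n) * l - 1) + 1) * \<bar>flat 1 (real (Suc n) * l - 1)\<bar>"
      by (simp add: side_factor'_def abs_mult)
    also have "\<dots> \<le> r n + (r n)\<^sup>2" unfolding r_def by (rule flat_1_bound(1)[OF elim])
    finally show ?case using assms by (simp add: pos_le_divide_eq mult.commute)
  qed
  ultimately show ?thesis by (rule Lim_null_comparison[rotated])
qed

text \<open>One factor per side: the three linear forms are simultaneously positive exactly on
  \<Omega>.\<close>

definition cutoff :: "nat \<Rightarrow> real \<times> real \<Rightarrow> real" where
  "cutoff N z = side_factor N (snd z) * (side_factor N (pi - fst z) * side_factor N (fst z - snd z))"

text \<open>The gradient of \<open>cutoff N\<close>, in the shape that two applications of the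
  product rule produce.\<close>

definition dcutoff :: "nat \<Rightarrow> real \<times> real \<Rightarrow> real \<times> real" where
  "dcutoff N z =
    side_factor N (snd z) *\<^sub>R
      (side_factor N (pi - fst z) *\<^sub>R (side_factor' N (fst z - snd z) *\<^sub>R (1, - 1)) +
       side_factor N (fst z - snd z) *\<^sub>R (side_factor' N (pi - fst z) *\<^sub>R (- 1, 0))) +
    (side_factor N (pi - fst z) * side_factor N (fst z - snd z)) *\<^sub>R
      (side_factor' N (snd z) *\<^sub>R (0, 1))"

lemma Ck_cutoff: "Ck k (cutoff N)" and GDERIV_cutoff: "GDERIV (cutoff N) z :> dcutoff N z"
proof -
  let ?l1 = "\<lambda>z. (0, 1) \<bullet> z + (0::real)" and ?l2 = "\<lambda>z. (- 1, 0) \<bullet> z + pi"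
    and ?l3 = "\<lambda>z. (1, - 1) \<bullet> z + (0::real)"
  have c: "cutoff N = (\<lambda>z. side_factor N (?l1 z) * (side_factor N (?l2 z) * side_factor N (?l3 z)))"
    by (simp add: fun_eq_iff cutoff_def inner_prod_def)
  have d: "dcutoff N z = side_factor N (?l1 z) *\<^sub>R
      (side_factor N (?l2 z) *\<^sub>R (side_factor' N (?l3 z) *\<^sub>R (1, - 1)) +
       side_factor N (?l3 z) *\<^sub>R (side_factor' N (?l2 z) *\<^sub>R (- 1, 0))) +
    (side_factor N (?l2 z) * side_factor N (?l3 z)) *\<^sub>R (side_factor' N (?l1 z) *\<^sub>R (0, 1))"
    by (simp add: dcutoff_def inner_prod_def)
  show "Ck k (cutoff N)" unfolding c by (intro Ck_mult Ck_side_factor)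
  show "GDERIV (cutoff N) z :> dcutoff N z" unfolding c d by (intro GDERIV_mult GDERIV_side_factor)
qed

lemma cutoff_support:
  assumes "N > 0"
  shows "compact (closure {z. cutoff N z * f z \<noteq> 0})" "closure {z. cutoff N z * f z \<noteq> 0} \<subseteq> \<Omega>"
proof -
  \<comment> \<open>Weak inequalities make \<open>K\<close> closed, while each linear form is still
    at least 1/N there, which keeps \<open>K\<close> inside \<Omega>.\<close>
  define K where "K = triangle \<inter> {z. 1 \<le> real N * snd z} \<inter> {z. 1 \<le> real N * (pi - fst z)} \<inter>
    {z. 1 \<le> real N * (fst z - snd z)}"
  have K: "compact K"
    unfolding K_def
    by (intro compact_Int_closed compact_triangle closed_Collect_le continuous_intros)
  have "z \<in> K" if "cutoff N z * f z \<noteq> 0" for z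
  proof -
    have *: "1 < real N * snd z" "1 < real N * (pi - fst z)" "1 < real N * (fst z - snd z)"
      using that side_factor_eq_0[of N] by (auto simp: cutoff_def not_le[symmetric] simp del: not_le)
    then have "snd z > 0" "pi - fst z > 0" "fst z - snd z > 0"
      by (smt (verit, best) of_nat_0_le_iff mult_nonneg_nonpos)+
    with * show ?thesis by (auto simp: K_def triangle_eq)
  qed
  then have sub: "closure {z. cutoff N z * f z \<noteq> 0} \<subseteq> K"
    using K by (intro closure_minimal) (auto intro: compact_imp_closed)
  then show "compact (closure {z. cutoff N z * f z \<noteq> 0})"
    using K by (meson closed_closure compact_closure compact_imp_bounded bounded_closure bounded_subset closure_subset order_trans)
  have "K \<subseteq> \<Omega>"
    unfolding interior_triangle K_def
  proof safe
    fix x y :: real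
    assume *: "1 \<le> real N * snd (x, y)" "1 \<le> real N * (pi - fst (x, y))" "1 \<le> real N * (fst (x, y) - snd (x, y))"
    then have "snd (x, y) > 0" "pi - fst (x, y) > 0" "fst (x, y) - snd (x, y) > 0"
      by (smt (verit, best) of_nat_0_le_iff mult_nonneg_nonpos)+
    then show "0 < snd (x, y)" "snd (x, y) < fst (x, y)" "fst (x, y) < pi" by auto
  qed
  with sub show "closure {z. cutoff N z * f z \<noteq> 0} \<subseteq> \<Omega>" by blast
qed

lemma test_function_cutoff:
  assumes "N > 0" "\<And>k. Ck k f"
  shows "test_function \<Omega> (\<lambda>z. cutoff N z * f z)"
  unfolding test_function_def
  using cutoff_support[OF assms(1)] assms(2) by (auto intro: Ck_mult Ck_cutoff)

lemma cutoff_bounds: "\<bar>cutoff N z\<bar> \<le> 1"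
  unfolding cutoff_def
  by (simp add: abs_mult) (intro mult_le_one mult_nonneg_nonneg abs_ge_zero; simp add: side_factor_bounds)

lemma cutoff_tendsto: "z \<in> \<Omega> \<Longrightarrow> (\<lambda>n. cutoff (Suc n) z) \<longlonglongrightarrow> 1"
  unfolding cutoff_def interior_triangle
  using tendsto_mult[OF side_factor_tendsto tendsto_mult[OF side_factor_tendsto side_factor_tendsto],
      of "snd z" "pi - fst z" "fst z - snd z"] by simp

text \<open>Sorted by sides: the derivative of each side factor meets only the derivative of
  \<open>phi m n\<close> normal to that side.\<close>

lemma dcutoff_inner_dphi:
  "dcutoff N z \<bullet> dphi m n z =
    side_factor N (snd z) * side_factor N (pi - fst z) *
      (side_factor' N (fst z - snd z) * (phi1 m n z - phi2 m n z)) +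
    side_factor N (snd z) * side_factor N (fst z - snd z) *
      (side_factor' N (pi - fst z) * - phi1 m n z) +
    side_factor N (pi - fst z) * side_factor N (fst z - snd z) *
      (side_factor' N (snd z) * phi2 m n z)"
  by (simp add: dcutoff_def dphi_def inner_prod_def algebra_simps)

text \<open>Each of the three sides contributes at most \<open>2 * normal_const m n\<close>,
  whatever \<open>N\<close> is; this is the domination needed in Green's formula.\<close>

lemma dcutoff_inner_dphi_bound:
  assumes "z \<in> \<Omega>"
  shows "\<bar>dcutoff N z \<bullet> dphi m n z\<bar> \<le> 6 * normal_const m n"
proof -
  have C: "normal_const m n \<ge> 0" by (simp add: normal_const_def)
  have "\<bar>side_factor N a * side_factor N b * x\<bar> \<le> \<bar>x\<bar>" for a b x
    by (simp add: abs_mult side_factor_bounds mult_le_one mult_left_le_one_le)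
  note * = order_trans[OF this]
  have "\<bar>side_factor N (snd z) * side_factor N (pi - fst z) *
      (side_factor' N (fst z - snd z) * (phi1 m n z - phi2 m n z))\<bar> \<le> 2 * normal_const m n"
    using assms abs_phi1_minus_phi2_le[of m n z] C
    by (intro * side_factor'_bound) (auto simp: interior_triangle)
  moreover have "\<bar>side_factor N (snd z) * side_factor N (fst z - snd z) *
      (side_factor' N (pi - fst z) * - phi1 m n z)\<bar> \<le> 2 * normal_const m n"
    using assms abs_phi1_le[of m n z] C
    by (intro * side_factor'_bound) (auto simp: interior_triangle)
  moreover have "\<bar>side_factor N (pi - fst z) * side_factor N (fst z - snd z) *
      (side_factor' N (snd z) * phi2 m n z)\<bar> \<le> 2 * normal_const m n"
    using assms abs_phi2_le[of m n z] C
    by (intro * side_factor'_bound) (auto simp: interior_triangle)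
  ultimately show ?thesis unfolding dcutoff_inner_dphi by linarith
qed

lemma dcutoff_tendsto:
  assumes "z \<in> \<Omega>"
  shows "(\<lambda>k. dcutoff (Suc k) z) \<longlonglongrightarrow> 0"
proof -
  have l: "snd z > 0" "pi - fst z > 0" "fst z - snd z > 0" using assms by (auto simp: interior_triangle)
  have "(\<lambda>k. dcutoff (Suc k) z) \<longlonglongrightarrow>
      1 *\<^sub>R (1 *\<^sub>R (0 *\<^sub>R (1, - 1)) + 1 *\<^sub>R (0 *\<^sub>R (- 1, 0))) + (1 * 1) *\<^sub>R (0 *\<^sub>R (0, 1))"
    unfolding dcutoff_def
    by (intro tendsto_add tendsto_scaleR tendsto_mult tendsto_const side_factor_tendsto
        side_factor'_tendsto l)
  then show ?thesis by (simp add: zero_prod_def)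
qed

lemma continuous_on_cutoff: "continuous_on A (cutoff N)"
  using Ck_cutoff[of 0 N] by (auto intro: continuous_on_subset)

lemma continuous_on_dcutoff: "continuous_on A (dcutoff N)"
proof -
  have "continuous_on UNIV (side_factor N)"
    using Ck_side_factor[of 0 N "1::real" 0] by simp
  then have 1: "continuous_on A (\<lambda>z. side_factor N (f z))" if "continuous_on A f" for f
    by (rule continuous_on_compose2[OF _ that subset_UNIV])
  have "continuous_on UNIV (flat 1)"
    using flat_has_derivative by (meson DERIV_continuous continuous_at_imp_continuous_on)
  then have 0: "continuous_on A (\<lambda>z. flat 1 (f z))" if "continuous_on A f" for f
    by (rule continuous_on_compose2[OF _ that subset_UNIV])
  have 2: "continuous_on A (\<lambda>z. side_factor' N (f z))" if "continuous_on A f" for f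
    unfolding side_factor'_def
    by (intro continuous_on_mult continuous_on_diff continuous_on_const 0 that)
  show ?thesis unfolding dcutoff_def[abs_def]
    by (intro continuous_on_add continuous_on_scaleR continuous_on_mult 1 2 continuous_on_const
        continuous_on_diff continuous_on_fst continuous_on_snd continuous_on_id)
qed

lemma H1_grad_component:
  assumes "continuous_on triangle u" "H1_grad \<Omega> u g" "test_function \<Omega> \<psi>"
    "\<And>z. GDERIV \<psi> z :> d\<psi> z" "continuous_on UNIV d\<psi>" "continuous_on UNIV \<psi>"
  shows "(LINT z|lebesgue_on \<Omega>. u z * (d\<psi> z \<bullet> b)) = - (LINT z|lebesgue_on \<Omega>. \<psi> z * (g z \<bullet> b))"
proof -
  have d: "continuous_on triangle d\<psi>" and p: "continuous_on triangle \<psi>"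
    using assms(5,6) by (auto intro: continuous_on_subset)
  have "integrable (lebesgue_on \<Omega>) (\<lambda>z. u z *\<^sub>R d\<psi> z)"
    by (intro integrable_\<Omega> continuous_intros assms d)
  then have 1: "(LINT z|lebesgue_on \<Omega>. u z * (d\<psi> z \<bullet> b)) = (LINT z|lebesgue_on \<Omega>. u z *\<^sub>R d\<psi> z) \<bullet> b"
    by (subst integral_inner_left[symmetric]) auto
  have "integrable (lebesgue_on \<Omega>) g"
    using assms(2) by (auto simp: H1_grad_def intro: square_integrable_imp_integrable_\<Omega>)
  then have "integrable (lebesgue_on \<Omega>) (\<lambda>z. \<psi> z *\<^sub>R g z)"
    by (intro integrable_mult_\<Omega> p)
  then have 2: "(LINT z|lebesgue_on \<Omega>. \<psi> z * (g z \<bullet> b)) = (LINT z|lebesgue_on \<Omega>. \<psi> z *\<^sub>R g z) \<bullet> b"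
    by (subst integral_inner_left[symmetric]) auto
  have "(LINT z|lebesgue_on \<Omega>. u z *\<^sub>R d\<psi> z) = - (LINT z|lebesgue_on \<Omega>. \<psi> z *\<^sub>R g z)"
    using assms(2,3,4) unfolding H1_grad_def by blast
  then show ?thesis unfolding 1 2 by (simp add: inner_minus_left)
qed

section \<open>Green's formula\<close>

text \<open>Testing against \<open>cutoff N\<close> times the partial derivatives of \<open>phi m n\<close> gives Green's formula
  in the limit: the boundary layer term stays bounded because the normal derivative of
  \<open>phi m n\<close> vanishes on each side.\<close>

lemma Green_phi:
  assumes u: "continuous_on triangle u" and H1: "H1_grad \<Omega> u g"
  shows "(LINT z|lebesgue_on \<Omega>. g z \<bullet> dphi m n z) =
    (real_of_int m ^ 2 + real_of_int n ^ 2) * (LINT z|lebesgue_on \<Omega>. u z * phi m n z)"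
proof -
  define M where "M = lebesgue_on \<Omega>"
  define \<mu> where "\<mu> = real_of_int m ^ 2 + real_of_int n ^ 2"
  \<comment> \<open>The first summand bounds the Laplacian term, since |phi| \<le> 2 and |cutoff|
    \<le> 1; the second bounds the boundary layer.\<close>
  define C where "C = 2 * \<mu> + 6 * normal_const m n"
  \<comment> \<open>Here \<open>f N\<close> is \<open>u\<close> times the divergence of the field
    \<open>cutoff N z *\<^sub>R dphi m n z\<close>, and \<open>h N\<close> is the inner product of
    \<open>g\<close> with that field.\<close>
  define f where "f N z = u z * (cutoff N z * (- \<mu> * phi m n z) + dcutoff N z \<bullet> dphi m n z)" for N z
  define h where "h N z = cutoff N z * (g z \<bullet> dphi m n z)" for N z
  have \<mu>: "\<mu> \<ge> 0" by (simp add: \<mu>_def)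
  have gint: "integrable M g"
    using H1 by (auto simp: M_def H1_grad_def intro: square_integrable_imp_integrable_\<Omega>)
  have gi1: "integrable M (\<lambda>z. phi1 m n z *\<^sub>R g z)" and gi2: "integrable M (\<lambda>z. phi2 m n z *\<^sub>R g z)"
    using gint unfolding M_def by (auto intro!: integrable_mult_\<Omega> continuous_on_phi1 continuous_on_phi2)
  have "integrable M (\<lambda>z. (phi1 m n z *\<^sub>R g z) \<bullet> (1, 0) + (phi2 m n z *\<^sub>R g z) \<bullet> (0, 1))"
    by (intro Bochner_Integration.integrable_add integrable_inner_left) (use gi1 gi2 in auto)
  moreover have "(phi1 m n z *\<^sub>R g z) \<bullet> (1, 0) + (phi2 m n z *\<^sub>R g z) \<bullet> (0, 1) = g z \<bullet> dphi m n z" for z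
    by (simp add: dphi_def inner_prod_def)
  ultimately have gd: "integrable M (\<lambda>z. g z \<bullet> dphi m n z)" by simp
  \<comment> \<open>The weak gradient identity is tested with both components of the field, one per
    coordinate direction, and the results are added. The index \<open>Suc k\<close> keeps the cutoff
    parameter positive.\<close>
  have eq: "(LINT z|M. f (Suc k) z) = - (LINT z|M. h (Suc k) z)" for k
  proof -
    let ?N = "Suc k"
    have c1: "continuous_on A (\<lambda>z. cutoff ?N z *\<^sub>R dphi1 m n z + phi1 m n z *\<^sub>R dcutoff ?N z)"
      and c2: "continuous_on A (\<lambda>z. cutoff ?N z *\<^sub>R dphi2 m n z + phi2 m n z *\<^sub>R dcutoff ?N z)" for A
      by (intro continuous_on_add continuous_on_scaleR continuous_on_cutoff continuous_on_dcutoff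
          continuous_on_phi1 continuous_on_phi2 continuous_on_dphi1 continuous_on_dphi2)+
    have 1: "(LINT z|M. u z * ((cutoff ?N z *\<^sub>R dphi1 m n z + phi1 m n z *\<^sub>R dcutoff ?N z) \<bullet> (1, 0))) =
        - (LINT z|M. (cutoff ?N z * phi1 m n z) * (g z \<bullet> (1, 0)))" (is "integral\<^sup>L M ?u1 = - integral\<^sup>L M ?g1")
      unfolding M_def
      by (intro H1_grad_component u H1 test_function_cutoff Ck_phi1 GDERIV_mult GDERIV_cutoff
          GDERIV_phi1 c1 continuous_on_mult continuous_on_cutoff continuous_on_phi1) simp
    have 2: "(LINT z|M. u z * ((cutoff ?N z *\<^sub>R dphi2 m n z + phi2 m n z *\<^sub>R dcutoff ?N z) \<bullet> (0, 1))) =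
        - (LINT z|M. (cutoff ?N z * phi2 m n z) * (g z \<bullet> (0, 1)))" (is "integral\<^sup>L M ?u2 = - integral\<^sup>L M ?g2")
      unfolding M_def
      by (intro H1_grad_component u H1 test_function_cutoff Ck_phi2 GDERIV_mult GDERIV_cutoff
          GDERIV_phi2 c2 continuous_on_mult continuous_on_cutoff continuous_on_phi2) simp
    have i1: "integrable M ?u1" and i2: "integrable M ?u2"
      unfolding M_def
      by (intro integrable_\<Omega> continuous_on_mult continuous_on_inner continuous_on_const c1 c2 u)+
    have j: "integrable M (\<lambda>z. (cutoff ?N z * phi1 m n z) *\<^sub>R (g z \<bullet> (1, 0)))"
      "integrable M (\<lambda>z. (cutoff ?N z * phi2 m n z) *\<^sub>R (g z \<bullet> (0, 1)))"
      using gint unfolding M_def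
      by (intro integrable_mult_\<Omega> continuous_on_mult continuous_on_cutoff continuous_on_phi1
          continuous_on_phi2 integrable_inner_left; simp)+
    have "f ?N = (\<lambda>z. ?u1 z + ?u2 z)"
    proof
      fix z
      have "?u1 z + ?u2 z = u z * (cutoff ?N z * (fst (dphi1 m n z) + snd (dphi2 m n z)) +
          dcutoff ?N z \<bullet> dphi m n z)"
        by (simp add: inner_prod_def dphi_def algebra_simps)
      then show "f ?N z = ?u1 z + ?u2 z" by (simp add: f_def laplace_phi \<mu>_def)
    qed
    moreover have "h ?N = (\<lambda>z. ?g1 z + ?g2 z)"
      by (simp add: fun_eq_iff h_def dphi_def inner_prod_def algebra_simps)
    ultimately show ?thesis using i1 i2 j 1 2 by simp
  qed
  have lim_f: "(\<lambda>k. LINT z|M. f (Suc k) z) \<longlonglongrightarrow> (LINT z|M. - \<mu> * (u z * phi m n z))"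
  proof (rule integral_dominated_convergence[where w = "\<lambda>z. C * \<bar>u z\<bar>"])
    show "(\<lambda>z. - \<mu> * (u z * phi m n z)) \<in> borel_measurable M"
      unfolding M_def by (intro measurable_\<Omega> continuous_on_mult continuous_on_const u continuous_on_phi)
    show "f (Suc k) \<in> borel_measurable M" for k
      unfolding M_def f_def
      by (intro measurable_\<Omega> continuous_on_mult continuous_on_add continuous_on_inner continuous_on_const u
          continuous_on_phi continuous_on_cutoff continuous_on_dcutoff continuous_on_dphi)
    show "integrable M (\<lambda>z. C * \<bar>u z\<bar>)"
      unfolding M_def by (intro integrable_\<Omega> continuous_on_mult continuous_on_const continuous_on_rabs u)
    show "AE z in M. (\<lambda>k. f (Suc k) z) \<longlonglongrightarrow> - \<mu> * (u z * phi m n z)"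
    proof (rule AE_I2)
      fix z assume "z \<in> space M"
      then have z: "z \<in> \<Omega>" by (simp add: M_def)
      have "(\<lambda>k. f (Suc k) z) \<longlonglongrightarrow> u z * (1 * (- \<mu> * phi m n z) + 0 \<bullet> dphi m n z)"
        unfolding f_def
        by (intro tendsto_mult tendsto_add tendsto_inner tendsto_const cutoff_tendsto dcutoff_tendsto z)
      then show "(\<lambda>k. f (Suc k) z) \<longlonglongrightarrow> - \<mu> * (u z * phi m n z)" by (simp add: algebra_simps)
    qed
    show "AE z in M. norm (f (Suc k) z) \<le> C * \<bar>u z\<bar>" for k
    proof (rule AE_I2)
      fix z assume "z \<in> space M"
      then have z: "z \<in> \<Omega>" by (simp add: M_def)
      have "\<bar>cutoff (Suc k) z\<bar> * (\<mu> * \<bar>phi m n z\<bar>) \<le> 1 * (\<mu> * 2)"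
        using \<mu> by (intro mult_mono cutoff_bounds abs_phi_le) auto
      then have "\<bar>cutoff (Suc k) z * (- \<mu> * phi m n z)\<bar> \<le> 2 * \<mu>" using \<mu> by (simp add: abs_mult)
      then have "\<bar>cutoff (Suc k) z * (- \<mu> * phi m n z) + dcutoff (Suc k) z \<bullet> dphi m n z\<bar> \<le> C"
        using dcutoff_inner_dphi_bound[OF z, of "Suc k" m n] unfolding C_def by linarith
      then show "norm (f (Suc k) z) \<le> C * \<bar>u z\<bar>"
        unfolding f_def real_norm_def abs_mult by (subst mult.commute) (rule mult_right_mono, auto)
    qed
  qed
  have lim_h: "(\<lambda>k. LINT z|M. h (Suc k) z) \<longlonglongrightarrow> (LINT z|M. g z \<bullet> dphi m n z)"
  proof (rule integral_dominated_convergence[where w = "\<lambda>z. \<bar>g z \<bullet> dphi m n z\<bar>"])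
    show "(\<lambda>z. g z \<bullet> dphi m n z) \<in> borel_measurable M"
      using gd by (rule borel_measurable_integrable)
    show "h (Suc k) \<in> borel_measurable M" for k
      unfolding h_def[abs_def] M_def
      by (intro borel_measurable_times measurable_\<Omega> continuous_on_cutoff
          borel_measurable_integrable[OF gd[unfolded M_def]])
    show "integrable M (\<lambda>z. \<bar>g z \<bullet> dphi m n z\<bar>)" using gd by simp
    show "AE z in M. (\<lambda>k. h (Suc k) z) \<longlonglongrightarrow> g z \<bullet> dphi m n z"
    proof (rule AE_I2)
      fix z assume "z \<in> space M"
      then have "(\<lambda>k. h (Suc k) z) \<longlonglongrightarrow> 1 * (g z \<bullet> dphi m n z)"
        unfolding h_def by (intro tendsto_mult tendsto_const cutoff_tendsto) (simp add: M_def)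
      then show "(\<lambda>k. h (Suc k) z) \<longlonglongrightarrow> g z \<bullet> dphi m n z" by simp
    qed
    show "AE z in M. norm (h (Suc k) z) \<le> \<bar>g z \<bullet> dphi m n z\<bar>" for k
      by (rule AE_I2) (simp add: h_def abs_mult mult_left_le_one_le cutoff_bounds)
  qed
  have "(LINT z|M. - \<mu> * (u z * phi m n z)) = - (LINT z|M. g z \<bullet> dphi m n z)"
    using lim_f[unfolded eq] tendsto_minus[OF lim_h] by (rule LIMSEQ_unique)
  then show ?thesis unfolding M_def[symmetric] \<mu>_def[symmetric] by simp
qed

section \<open>The trigonometric functions in the form domain\<close>

lemma test_functionE:
  assumes "test_function S \<psi>" "\<And>x. GDERIV \<psi> x :> d\<psi> x"
  shows "continuous_on UNIV \<psi>" "continuous_on UNIV d\<psi>"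
proof -
  have "Ck 0 \<psi>" "Ck (Suc 0) \<psi>" using assms(1) by (auto simp: test_function_def simp del: Ck.simps)
  then show "continuous_on UNIV \<psi>" by simp
  obtain D where D: "\<And>x. GDERIV \<psi> x :> D x" "\<And>b. b \<in> Basis \<Longrightarrow> continuous_on UNIV (\<lambda>x. D x \<bullet> b)"
    using \<open>Ck (Suc 0) \<psi>\<close> by auto
  \<comment> \<open>\<open>Ck\<close> provides only some continuous gradient; uniqueness of the
    derivative, applied to the direction \<open>D x - d\<psi> x\<close>, identifies it with the
    given one.\<close>
  have "D = d\<psi>"
  proof
    fix x
    have "(\<lambda>h. h \<bullet> D x) = (\<lambda>h. h \<bullet> d\<psi> x)"
      using D(1)[of x] assms(2)[of x] by (auto simp: gderiv_def intro: has_derivative_unique)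
    then have "(D x - d\<psi> x) \<bullet> D x = (D x - d\<psi> x) \<bullet> d\<psi> x" by metis
    then have "(D x - d\<psi> x) \<bullet> (D x - d\<psi> x) = 0" by (simp add: inner_diff_right)
    then show "D x = d\<psi> x" by simp
  qed
  with D(2) show "continuous_on UNIV d\<psi>" by (auto intro: continuous_on_componentwise[THEN iffD2])
qed

lemma integral_lebesgue_on_eq_lborel:
  fixes f :: "'a::euclidean_space \<Rightarrow> 'b::euclidean_space"
  assumes "f \<in> borel_measurable borel" "S \<in> sets lebesgue" "\<And>x. x \<notin> S \<Longrightarrow> f x = 0"
  shows "(LINT x|lebesgue_on S. f x) = (LINT x|lborel. f x)"
proof -
  have "(LINT x|lebesgue_on S. f x) = (LINT x|lebesgue. indicator S x *\<^sub>R f x)"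
    using assms(2) by (subst integral_restrict_space) auto
  also have "(\<lambda>x. indicator S x *\<^sub>R f x) = f"
    using assms(3) by (auto simp: fun_eq_iff indicator_def)
  finally show ?thesis using assms(1) by (simp add: integral_completion)
qed

text \<open>By the product rule \<open>F\<close> is the gradient of \<open>phi m n\<close> times a
  test function. This product has compact support in \<Omega>, so \<open>F\<close> integrates to
  0.\<close>

lemma H1_grad_phi: "H1_grad \<Omega> (phi m n) (dphi m n)"
  unfolding H1_grad_def
proof (intro conjI allI impI square_integrable_\<Omega> continuous_on_phi continuous_on_dphi)
  fix \<psi> d\<psi> assume \<psi>: "test_function \<Omega> \<psi>" and d: "\<forall>z. GDERIV \<psi> z :> d\<psi> z"
  define K where "K = closure {z. \<psi> z \<noteq> 0}"
  have K: "compact K" "K \<subseteq> \<Omega>" using \<psi> by (auto simp: test_function_def K_def)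
  have z0: "\<psi> z = 0" if "z \<notin> K" for z using that closure_subset[of "{z. \<psi> z \<noteq> 0}"] by (auto simp: K_def)
  note c = test_functionE[OF \<psi> d[rule_format]]
  define F where "F z = phi m n z *\<^sub>R d\<psi> z + \<psi> z *\<^sub>R dphi m n z" for z
  have cF: "continuous_on UNIV F"
    unfolding F_def[abs_def]
    by (intro continuous_on_add continuous_on_scaleR c continuous_on_phi continuous_on_dphi)
  have GF: "GDERIV (\<lambda>z. phi m n z * \<psi> z) z :> F z" for z
    unfolding F_def by (intro GDERIV_mult GDERIV_phi d[rule_format])
  have F0: "F z = 0" if "z \<notin> K" for z
    using K z0 that by (intro GDERIV_eq_0_outside[OF GF, of K]) (auto intro: compact_imp_closed)
  have meas: "F \<in> borel_measurable borel" using cF by (rule borel_measurable_continuous_onI)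
  have "integrable lborel (\<lambda>z. indicator K z *\<^sub>R F z)"
    by (rule borel_integrable_compact) (use K cF in \<open>auto intro: continuous_on_subset\<close>)
  moreover have "(\<lambda>z. indicator K z *\<^sub>R F z) = F" using F0 by (auto simp: fun_eq_iff indicator_def)
  ultimately have intF: "integrable lborel F" by simp
  have "(LINT z|lborel. F z) \<bullet> b = 0" for b
    using integral_gradient_eq_0[OF GF cF K(1), of b] z0 intF
    by (subst integral_inner_left[symmetric]) auto
  from this[of "LINT z|lborel. F z"] have "(LINT z|lborel. F z) = 0" by simp
  moreover have "(LINT z|lebesgue_on \<Omega>. F z) = (LINT z|lborel. F z)"
    by (rule integral_lebesgue_on_eq_lborel[OF meas sets_\<Omega>]) (use F0 K in auto)
  moreover have "(LINT z|lebesgue_on \<Omega>. F z) =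
      (LINT z|lebesgue_on \<Omega>. phi m n z *\<^sub>R d\<psi> z) + (LINT z|lebesgue_on \<Omega>. \<psi> z *\<^sub>R dphi m n z)"
    unfolding F_def
    by (intro Bochner_Integration.integral_add integrable_\<Omega> continuous_on_scaleR continuous_on_phi
        continuous_on_dphi continuous_on_subset[OF c(1)] continuous_on_subset[OF c(2)] subset_UNIV)
  ultimately show "(LINT z|lebesgue_on \<Omega>. phi m n z *\<^sub>R d\<psi> z) =
      - (LINT z|lebesgue_on \<Omega>. \<psi> z *\<^sub>R dphi m n z)"
    by (simp add: eq_neg_iff_add_eq_0)
qed

text \<open>With \<open>phi m n\<close> as the test function, the weak equation and Green's formula
  express the same integral as two different multiples of the inner product of \<open>u\<close> and
  \<open>phi m n\<close>.\<close>

lemma eigenfunction_orthogonal: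
  assumes "neumann_eigenfunction \<mu> u" "real_of_int m ^ 2 + real_of_int n ^ 2 \<noteq> \<mu>"
  shows "(LINT z|lebesgue_on \<Omega>. u z * phi m n z) = 0"
proof -
  obtain g where u: "continuous_on triangle u" and g: "H1_grad \<Omega> u g"
    and eq: "\<And>v h. H1_grad \<Omega> v h \<Longrightarrow>
        (LINT z|lebesgue_on \<Omega>. g z \<bullet> h z) = \<mu> * (LINT z|lebesgue_on \<Omega>. u z * v z)"
    using assms(1) unfolding neumann_eigenfunction_def by blast
  show ?thesis
    using eq[OF H1_grad_phi, of m n] Green_phi[OF u g, of m n] assms(2) by simp
qed

section \<open>Reflection and folding\<close>

text \<open>Integration of an indicator against \<open>lborel\<close> gives direct access to Fubini
  and to linear substitutions; for continuous functions it agrees with integration over \<Omega>, as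
  the frontier of a convex set is negligible.\<close>

definition tri_integral :: "(real \<times> real \<Rightarrow> real) \<Rightarrow> real" where
  "tri_integral f = (LINT z|lborel. indicator triangle z * f z)"

lemma sets_triangle: "triangle \<in> sets borel"
  using compact_triangle by (intro borel_closed compact_imp_closed)

lemma integrable_triangle:
  assumes "continuous_on triangle f"
  shows "integrable lborel (\<lambda>z. indicator triangle z * (f z :: real))"
  using borel_integrable_compact[OF compact_triangle assms] by simp

lemma measurable_triangle:
  assumes "continuous_on triangle f"
  shows "(\<lambda>z. indicator triangle z * (f z :: real)) \<in> borel_measurable borel"
  using borel_measurable_continuous_on_indicator[OF sets_triangle assms] by simp

lemma integral_interior_triangle:
  assumes f: "continuous_on triangle f"
  shows "(LINT z|lebesgue_on \<Omega>. f z) = tri_integral f"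
proof -
  have m: "(\<lambda>z. indicator triangle z * f z) \<in> borel_measurable borel"
    by (rule measurable_triangle[OF f])
  have "(LINT z|lebesgue_on \<Omega>. f z) = (LINT z|lebesgue_on \<Omega>. indicator \<Omega> z * (indicator triangle z * f z))"
    using interior_subset[of triangle] by (intro Bochner_Integration.integral_cong) auto
  also have "\<dots> = (LINT z|lborel. indicator \<Omega> z * (indicator triangle z * f z))"
    by (intro integral_lebesgue_on_eq_lborel sets_\<Omega> borel_measurable_times m borel_measurable_indicator) auto
  also have "\<dots> = tri_integral f"
    unfolding tri_integral_def
  proof (rule integral_cong_AE)
    show "(\<lambda>z. indicator \<Omega> z * (indicator triangle z * f z)) \<in> borel_measurable lborel"
      using m by (simp add: borel_measurable_indicator)
    show "(\<lambda>z. indicator triangle z * f z) \<in> borel_measurable lborel"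
      using m by simp
    have "AE z in lborel. z \<notin> frontier triangle"
      using negligible_convex_frontier[OF convex_triangle]
      by (simp add: negligible_iff_null_sets null_sets_completion_iff AE_not_in)
    then show "AE z in lborel. indicator \<Omega> z * (indicator triangle z * f z) = indicator triangle z * f z"
    proof eventually_elim
      case (elim z)
      then show ?case
        using closure_subset[of triangle] by (auto simp: frontier_def indicator_def)
    qed
  qed
  finally show ?thesis .
qed

section \<open>Substitution by the reflection and the folding map\<close>

lemma integral_substitution:
  fixes T :: "'a::euclidean_space \<Rightarrow> 'a" and f :: "'a \<Rightarrow> real"
  assumes T[measurable]: "T \<in> borel_measurable borel" and c: "c \<ge> 0"
    and nn: "\<And>g. g \<in> borel_measurable borel \<Longrightarrow>
      (\<integral>\<^sup>+z. g z \<partial>lborel) = ennreal c * (\<integral>\<^sup>+z. g (T z) \<partial>lborel)"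
    and f[measurable]: "f \<in> borel_measurable borel"
  shows "(LINT z|lborel. f z) = c * (LINT z|lborel. f (T z))"
proof -
  \<comment> \<open>The substitution rule for nonnegative functions, applied to indicators, is an
    identity of measures; it then transfers to signed functions with no integrability
    condition.\<close>
  have "lborel = density (distr lborel borel T) (\<lambda>_. ennreal c)"
  proof (rule measure_eqI)
    fix A :: "'a set" assume "A \<in> sets lborel"
    then have A[measurable]: "A \<in> sets borel" by simp
    have "emeasure lborel A = (\<integral>\<^sup>+z. indicator A z \<partial>lborel)" by simp
    also have "\<dots> = ennreal c * (\<integral>\<^sup>+z. indicator A (T z) \<partial>lborel)" by (rule nn) measurable
    also have "(\<integral>\<^sup>+z. indicator A (T z) \<partial>lborel) = (\<integral>\<^sup>+z. indicator A z \<partial>distr lborel borel T)"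
      by (subst nn_integral_distr) auto
    also have "ennreal c * \<dots> = emeasure (density (distr lborel borel T) (\<lambda>_. ennreal c)) A"
      by (subst emeasure_density) (auto simp: nn_integral_cmult)
    finally show "emeasure lborel A = emeasure (density (distr lborel borel T) (\<lambda>_. ennreal c)) A" .
  qed simp
  then have "(LINT z|lborel. f z) = (LINT z|density (distr lborel borel T) (\<lambda>_. ennreal c). f z)" by simp
  also have "\<dots> = (LINT z|distr lborel borel T. c *\<^sub>R f z)"
    using c by (subst integral_density) auto
  also have "\<dots> = (LINT z|lborel. c *\<^sub>R f (T z))"
    by (subst integral_distr) auto
  finally show ?thesis by simp
qed

lemma nn_integral_plane:
  fixes g :: "real \<times> real \<Rightarrow> ennreal"
  assumes "g \<in> borel_measurable borel"
  shows "(\<integral>\<^sup>+z. g z \<partial>lborel) = (\<integral>\<^sup>+x. (\<integral>\<^sup>+y. g (x, y) \<partial>lborel) \<partial>lborel)"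
    and "(\<integral>\<^sup>+z. g z \<partial>lborel) = (\<integral>\<^sup>+y. (\<integral>\<^sup>+x. g (x, y) \<partial>lborel) \<partial>lborel)"
proof -
  have g: "g \<in> borel_measurable (lborel \<Otimes>\<^sub>M lborel)" using assms by (simp add: lborel_prod)
  show "(\<integral>\<^sup>+z. g z \<partial>lborel) = (\<integral>\<^sup>+x. (\<integral>\<^sup>+y. g (x, y) \<partial>lborel) \<partial>lborel)"
    using lborel.nn_integral_fst[OF g] by (simp add: lborel_prod)
  show "(\<integral>\<^sup>+z. g z \<partial>lborel) = (\<integral>\<^sup>+y. (\<integral>\<^sup>+x. g (x, y) \<partial>lborel) \<partial>lborel)"
    using lborel_pair.nn_integral_snd[OF g] by (simp add: lborel_prod)
qed

lemma measurable_R_map: "R_map \<in> borel_measurable borel"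
  and measurable_F_map: "F_map \<in> borel_measurable borel"
  unfolding R_map_def F_map_def case_prod_beta
  by (intro borel_measurable_continuous_onI continuous_intros)+

lemma integral_R_map:
  fixes f :: "real \<times> real \<Rightarrow> real"
  assumes f: "f \<in> borel_measurable borel"
  shows "(LINT z|lborel. f z) = (LINT z|lborel. f (R_map z))"
proof -
  have "(LINT z|lborel. f z) = 1 * (LINT z|lborel. f (R_map z))"
  proof (rule integral_substitution[OF measurable_R_map _ _ f])
    fix g :: "real \<times> real \<Rightarrow> ennreal" assume g[measurable]: "g \<in> borel_measurable borel"
    note [measurable] = measurable_R_map
    have p: "(\<lambda>x. g (x, y)) \<in> borel_measurable borel" "(\<lambda>x. g (y, x)) \<in> borel_measurable borel" for y
      by (rule measurable_compose[OF _ g]; measurable)+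
    have s: "(\<integral>\<^sup>+x. h x \<partial>lborel) = (\<integral>\<^sup>+x. h (pi - x) \<partial>lborel)"
      if "h \<in> borel_measurable borel" for h :: "real \<Rightarrow> ennreal"
      using nn_integral_real_affine[OF that, of "-1" pi] by simp
    have "(\<integral>\<^sup>+z. g (R_map z) \<partial>lborel) = (\<integral>\<^sup>+y. (\<integral>\<^sup>+x. g (pi - y, pi - x) \<partial>lborel) \<partial>lborel)"
      using nn_integral_plane(2)[OF measurable_compose[OF measurable_R_map g]]
      by (simp add: R_map_def case_prod_beta)
    also have "\<dots> = (\<integral>\<^sup>+y. (\<integral>\<^sup>+x. g (pi - y, x) \<partial>lborel) \<partial>lborel)"
      by (subst s[symmetric, OF p(2)]) (rule refl)
    also have "\<dots> = (\<integral>\<^sup>+y. (\<integral>\<^sup>+x. g (y, x) \<partial>lborel) \<partial>lborel)"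
      by (rule s[symmetric]) measurable
    also have "\<dots> = (\<integral>\<^sup>+z. g z \<partial>lborel)" by (rule nn_integral_plane(1)[symmetric, OF g])
    finally show "(\<integral>\<^sup>+z. g z \<partial>lborel) = ennreal 1 * (\<integral>\<^sup>+z. g (R_map z) \<partial>lborel)" by simp
  qed simp
  then show ?thesis by simp
qed

text \<open>The factor 2 is the absolute determinant of \<open>F_map\<close>. A translation of the
  first variable turns (x + y, x - y) into (x, x - 2 y); after exchanging the order of integration,
  scaling y by -2 produces the factor.\<close>

lemma integral_F_map:
  fixes f :: "real \<times> real \<Rightarrow> real"
  assumes f: "f \<in> borel_measurable borel"
  shows "(LINT z|lborel. f z) = 2 * (LINT z|lborel. f (F_map z))"
proof (rule integral_substitution[OF measurable_F_map _ _ f])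
  fix g :: "real \<times> real \<Rightarrow> ennreal" assume g[measurable]: "g \<in> borel_measurable borel"
  note [measurable] = measurable_F_map
  have p: "(\<lambda>x. g (x, x - 2 * y)) \<in> borel_measurable borel" "(\<lambda>x. g (y, x)) \<in> borel_measurable borel" for y
    by (rule measurable_compose[OF _ g]; measurable)+
  have q: "(\<lambda>z. g (fst z, fst z - 2 * snd z)) \<in> borel_measurable borel"
    by (rule measurable_compose[OF _ g], intro borel_measurable_continuous_onI continuous_intros)
  have r: "(\<lambda>x. (\<integral>\<^sup>+y. g (x, x - 2 * y) \<partial>lborel)) \<in> borel_measurable lborel"
    using q by measurable
  have "(\<integral>\<^sup>+z. g (F_map z) \<partial>lborel) = (\<integral>\<^sup>+y. (\<integral>\<^sup>+x. g (x + y, x - y) \<partial>lborel) \<partial>lborel)"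
    using nn_integral_plane(2)[OF measurable_compose[OF measurable_F_map g]]
    by (simp add: F_map_def case_prod_beta)
  also have "\<dots> = (\<integral>\<^sup>+y. (\<integral>\<^sup>+x. g (x, x - 2 * y) \<partial>lborel) \<partial>lborel)"
  proof (rule nn_integral_cong)
    fix y :: real
    have "(\<integral>\<^sup>+x. g (x, x - 2 * y) \<partial>lborel) = (\<integral>\<^sup>+x. g (y + x, (y + x) - 2 * y) \<partial>lborel)"
      using nn_integral_real_affine[OF p(1)[of y], of 1 y] by simp
    also have "\<dots> = (\<integral>\<^sup>+x. g (x + y, x - y) \<partial>lborel)"
      by (rule nn_integral_cong, rule arg_cong[where f = g]) simp
    finally show "(\<integral>\<^sup>+x. g (x + y, x - y) \<partial>lborel) = (\<integral>\<^sup>+x. g (x, x - 2 * y) \<partial>lborel)" ..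
  qed
  also have "\<dots> = (\<integral>\<^sup>+x. (\<integral>\<^sup>+y. g (x, x - 2 * y) \<partial>lborel) \<partial>lborel)"
    using nn_integral_plane[OF q] by simp
  finally have "ennreal 2 * (\<integral>\<^sup>+z. g (F_map z) \<partial>lborel) =
      (\<integral>\<^sup>+x. ennreal 2 * (\<integral>\<^sup>+y. g (x, x - 2 * y) \<partial>lborel) \<partial>lborel)"
    using r by (simp add: nn_integral_cmult)
  also have "\<dots> = (\<integral>\<^sup>+x. (\<integral>\<^sup>+y. g (x, y) \<partial>lborel) \<partial>lborel)"
    using nn_integral_real_affine[OF p(2), of "-2"] by simp
  also have "\<dots> = (\<integral>\<^sup>+z. g z \<partial>lborel)" by (rule nn_integral_plane(1)[symmetric, OF g])
  finally show "(\<integral>\<^sup>+z. g z \<partial>lborel) = ennreal 2 * (\<integral>\<^sup>+z. g (F_map z) \<partial>lborel)" by simp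
qed simp

lemma R_map_triangle: "R_map z \<in> triangle \<longleftrightarrow> z \<in> triangle"
  by (cases z) (auto simp: R_map_def triangle_eq)

lemma F_map_triangle: "F_map z \<in> triangle \<longleftrightarrow> z \<in> triangle \<and> fst z + snd z \<le> pi"
  by (cases z) (auto simp: F_map_def triangle_eq)

lemma tri_integral_R_map:
  assumes "continuous_on triangle f"
  shows "tri_integral (\<lambda>z. f (R_map z)) = tri_integral f"
  unfolding tri_integral_def
  using integral_R_map[OF measurable_triangle[OF assms]]
  by (simp add: indicator_def R_map_triangle)

text \<open>Substitution by \<open>F_map\<close> turns the integral of \<open>w\<close> into twice
  the integral of \<open>g\<close> over the half triangle; by symmetry under \<open>R_map\<close>
  the other half contributes the same amount.\<close>

lemma tri_integral_fold:
  assumes w: "continuous_on triangle w" and g: "continuous_on triangle g"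
    and sym: "\<And>z. z \<in> triangle \<Longrightarrow> g (R_map z) = g z"
    and eq: "\<And>z. F_map z \<in> triangle \<Longrightarrow> g z = w (F_map z)"
  shows "tri_integral w = tri_integral g"
proof -
  let ?G = "\<lambda>z. indicator triangle z * g z"
  define H where "H = {z::real \<times> real. fst z + snd z \<le> pi}"
  have H: "H \<in> sets borel"
    unfolding H_def by (intro borel_closed closed_Collect_le continuous_intros)
  have G: "integrable lborel ?G" "?G \<in> borel_measurable borel"
    using integrable_triangle[OF g] measurable_triangle[OF g] by auto
  have i: "integrable lborel (\<lambda>z. indicator H z * ?G z)" "integrable lborel (\<lambda>z. indicator (- H) z * ?G z)"
    using integrable_mult_indicator[OF _ G(1), of H] integrable_mult_indicator[OF _ G(1), of "- H"] H
    by simp_all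
  have "tri_integral w = 2 * (LINT z|lborel. indicator triangle (F_map z) * w (F_map z))"
    unfolding tri_integral_def by (rule integral_F_map[OF measurable_triangle[OF w]])
  also have "(\<lambda>z. indicator triangle (F_map z) * w (F_map z)) = (\<lambda>z. indicator H z * ?G z)"
    using eq by (auto simp: fun_eq_iff indicator_def F_map_triangle H_def)
  finally have 1: "tri_integral w = 2 * (LINT z|lborel. indicator H z * ?G z)" .
  have "(LINT z|lborel. indicator (- H) z * ?G z) = (LINT z|lborel. indicator (- H) (R_map z) * ?G (R_map z))"
    using H by (intro integral_R_map borel_measurable_times[OF _ G(2)] borel_measurable_indicator) auto
  also have "\<dots> = (LINT z|lborel. indicator H z * ?G z)"
  proof (rule integral_cong_AE)
    show "(\<lambda>z. indicator (- H) (R_map z) * ?G (R_map z)) \<in> borel_measurable lborel"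
    proof -
      have "(\<lambda>z. indicator (- H) z * ?G z) \<in> borel_measurable borel"
        using H by (intro borel_measurable_times[OF _ G(2)] borel_measurable_indicator) auto
      from measurable_compose[OF measurable_R_map this] show ?thesis by simp
    qed
    show "(\<lambda>z. indicator H z * ?G z) \<in> borel_measurable lborel"
      using i by (intro borel_measurable_integrable)
    \<comment> \<open>\<open>R_map\<close> exchanges the two sides of the line x + y = pi, so the
      two integrands can differ only on this null set.\<close>
    have "negligible {z::real \<times> real. (1, 1) \<bullet> z = pi}"
      by (rule negligible_hyperplane) (simp add: zero_prod_def)
    then have "{z::real \<times> real. (1, 1) \<bullet> z = pi} \<in> null_sets lebesgue"
      by (simp add: negligible_iff_null_sets)
    then have "{z::real \<times> real. (1, 1) \<bullet> z = pi} \<in> null_sets lborel"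
      by (subst (asm) null_sets_completion_iff) (auto intro!: borel_closed closed_hyperplane)
    from AE_not_in[OF this]
    show "AE z in lborel. indicator (- H) (R_map z) * ?G (R_map z) = indicator H z * ?G z"
    proof eventually_elim
      case (elim z)
      then show ?case
        using sym[of z]
        by (auto simp: indicator_def R_map_triangle) (auto simp: H_def R_map_def case_prod_beta inner_prod_def)
    qed
  qed
  finally have 2: "(LINT z|lborel. indicator (- H) z * ?G z) = (LINT z|lborel. indicator H z * ?G z)" .
  have "tri_integral g = (LINT z|lborel. indicator H z * ?G z + indicator (- H) z * ?G z)"
    unfolding tri_integral_def by (rule Bochner_Integration.integral_cong) (auto simp: indicator_def)
  also have "\<dots> = (LINT z|lborel. indicator H z * ?G z) + (LINT z|lborel. indicator (- H) z * ?G z)"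
    by (rule Bochner_Integration.integral_add[OF i])
  finally show ?thesis using 1 2 by simp
qed

section \<open>Completeness\<close>

text \<open>The linear span of the \<open>phi m n\<close>. Product-to-sum formulas make it an
  algebra, as Stone--Weierstrass requires.\<close>

inductive trig_poly :: "(real \<times> real \<Rightarrow> real) \<Rightarrow> bool" where
  phi: "trig_poly (phi m n)"
| add: "trig_poly f \<Longrightarrow> trig_poly g \<Longrightarrow> trig_poly (\<lambda>z. f z + g z)"
| scale: "trig_poly f \<Longrightarrow> trig_poly (\<lambda>z. c * f z)"

lemma phi_mult_phi:
  "phi m n z * phi p q z = (1 / 4) *
    ((phi (m + p) (n + q) z + phi (m + p) (n - q) z + (phi (m - p) (n + q) z + phi (m - p) (n - q) z)) +
     (phi (m + q) (n + p) z + phi (m + q) (n - p) z + (phi (m - q) (n + p) z + phi (m - q) (n - p) z)))"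
  by (simp add: phi_def distrib_right left_diff_distrib cos_add cos_diff) (simp add: algebra_simps)

lemma trig_poly_mult_phi: "trig_poly f \<Longrightarrow> trig_poly (\<lambda>z. f z * phi p q z)"
proof (induction rule: trig_poly.induct)
  case (phi m n)
  show ?case unfolding phi_mult_phi by (intro trig_poly.intros)
next
  case (add f g)
  then show ?case using trig_poly.add[OF add.IH] by (simp add: distrib_right)
next
  case (scale f c)
  then show ?case using trig_poly.scale[OF scale.IH, of c] by (simp add: mult.assoc)
qed

lemma trig_poly_mult: "trig_poly g \<Longrightarrow> trig_poly f \<Longrightarrow> trig_poly (\<lambda>z. f z * g z)"
proof (induction rule: trig_poly.induct)
  case (phi m n)
  then show ?case by (rule trig_poly_mult_phi)
next
  case (add g h)
  then show ?case using trig_poly.add[OF add.IH] by (simp add: distrib_left)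
next
  case (scale g c)
  then show ?case using trig_poly.scale[OF scale.IH, of c] by (simp add: mult.left_commute)
qed

lemma trig_poly_const: "trig_poly (\<lambda>z. c)"
  using trig_poly.scale[OF trig_poly.phi[of 0 0], of "c / 2"] by (simp add: phi_def)

lemma trig_poly_continuous: "trig_poly f \<Longrightarrow> continuous_on A f"
  by (induction rule: trig_poly.induct) (auto intro: continuous_on_phi continuous_intros)

text \<open>The triangle is the set of unordered pairs \<open>{x, y}\<close> in \<open>[0, \<pi>]\<close>; the elementary symmetric
  functions of \<open>cos x\<close> and \<open>cos y\<close> separate its points.\<close>

lemma phi_separates:
  assumes "z \<in> triangle" "z' \<in> triangle" "phi 1 0 z = phi 1 0 z'" "phi 1 1 z = phi 1 1 z'"
  shows "z = z'"
proof -
  define a b a' b' where ab: "a = cos (fst z)" "b = cos (snd z)" "a' = cos (fst z')" "b' = cos (snd z')"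
  have t: "0 \<le> snd z" "snd z \<le> fst z" "fst z \<le> pi" "0 \<le> snd z'" "snd z' \<le> fst z'" "fst z' \<le> pi"
    using assms(1,2) by (auto simp: triangle_eq)
  have le: "a \<le> b" "a' \<le> b'" unfolding ab using t by (auto intro!: cos_monotone_0_pi_le)
  have s: "a + b = a' + b'" "a * b = a' * b'"
    using assms(3,4) by (auto simp: phi_def ab mult.commute)
  \<comment> \<open>Equal sum and product mean that \<open>a\<close> is a root of the quadratic with
    roots \<open>a'\<close> and \<open>b'\<close>; the ordering \<open>a \<le> b\<close>,
    \<open>a' \<le> b'\<close> then excludes an exchange of the roots.\<close>
  have "(a - a') * (a - b') = a * a - a * (a' + b') + a' * b'" by (simp add: algebra_simps)
  also have "\<dots> = 0" unfolding s[symmetric] by (simp add: algebra_simps)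
  finally have "a = a' \<or> a = b'" by simp
  then have "a = a'" "b = b'" using s(1) le by auto
  then have "fst z = fst z'" "snd z = snd z'" unfolding ab using t by (auto intro!: cos_inj_pi)
  then show ?thesis by (simp add: prod_eq_iff)
qed

lemma trig_poly_dense:
  assumes "continuous_on triangle f" "e > 0"
  obtains g where "trig_poly g" "\<And>z. z \<in> triangle \<Longrightarrow> \<bar>f z - g z\<bar> < e"
proof -
  have "\<exists>g. trig_poly g \<and> (\<forall>z\<in>triangle. \<bar>f z - g z\<bar> < e)"
  proof (rule Stone_Weierstrass_HOL[OF compact_triangle])
    fix z z' assume "z \<in> triangle \<and> z' \<in> triangle \<and> z \<noteq> z'"
    then have "phi 1 0 z \<noteq> phi 1 0 z' \<or> phi 1 1 z \<noteq> phi 1 1 z'" using phi_separates by blast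
    then show "\<exists>f. trig_poly f \<and> f z \<noteq> f z'" using trig_poly.phi by blast
  qed (auto intro: trig_poly_const trig_poly_continuous trig_poly.add trig_poly_mult assms)
  then show ?thesis using that by blast
qed

lemma tri_integral_add:
  "continuous_on triangle f \<Longrightarrow> continuous_on triangle g \<Longrightarrow>
    tri_integral (\<lambda>z. f z + g z) = tri_integral f + tri_integral g"
  unfolding tri_integral_def
  using Bochner_Integration.integral_add[OF integrable_triangle integrable_triangle]
  by (simp add: distrib_left)

lemma tri_integral_mult_left: "tri_integral (\<lambda>z. c * f z) = c * tri_integral f"
  unfolding tri_integral_def
  by (subst integral_mult_right_zero[symmetric]) (simp add: mult.left_commute)

lemma tri_integral_mono:
  "continuous_on triangle f \<Longrightarrow> continuous_on triangle g \<Longrightarrow> (\<And>z. z \<in> triangle \<Longrightarrow> f z \<le> g z) \<Longrightarrow>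
    tri_integral f \<le> tri_integral g"
  unfolding tri_integral_def
  by (intro integral_mono integrable_triangle) (auto simp: indicator_def)

text \<open>The nonzero set of \<open>u\<close> within \<Omega> is open and negligible, hence empty;
  continuity extends the vanishing to the closure of \<Omega>.\<close>

lemma tri_integral_square_eq_0:
  assumes u: "continuous_on triangle u" and 0: "tri_integral (\<lambda>z. u z * u z) = 0"
  shows "\<forall>z\<in>triangle. u z = 0"
proof -
  have "AE z in lborel. indicator triangle z * (u z * u z) = 0"
    using 0 unfolding tri_integral_def
    by (subst (asm) integral_nonneg_eq_0_iff_AE)
       (auto intro!: integrable_triangle continuous_on_mult u)
  then obtain N where N: "N \<in> null_sets lborel" "{z. \<not> indicator triangle z * (u z * u z) = 0} \<subseteq> N"
    by (auto simp: eventually_ae_filter)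
  have neg: "negligible N"
    using N(1) by (simp add: negligible_iff_null_sets null_sets_completionI)
  have "open (\<Omega> \<inter> u -` (- {0}))"
    using u interior_subset by (intro continuous_open_preimage) (auto intro: continuous_on_subset)
  moreover have "\<Omega> \<inter> u -` (- {0}) \<subseteq> N"
    using N(2) interior_subset[of triangle] by (auto simp: indicator_def)
  ultimately have "\<Omega> \<inter> u -` (- {0}) = {}"
    using open_not_negligible negligible_subset[OF neg] by blast
  then have "\<Omega> \<subseteq> {z \<in> triangle. u z = 0}" using interior_subset[of triangle] by auto
  moreover have "closed {z \<in> triangle. u z = 0}"
    by (intro continuous_closed_preimage_constant u compact_imp_closed compact_triangle)
  ultimately have "closure \<Omega> \<subseteq> {z \<in> triangle. u z = 0}" by (rule closure_minimal)
  moreover have "closure \<Omega> = triangle"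
  proof -
    \<comment> \<open>A convex set with nonempty interior has the same closure as its
      interior.\<close>
    have "(2, 1) \<in> \<Omega>" using pi_gt3 by (simp add: interior_triangle)
    then have "closure \<Omega> = closure triangle" by (intro convex_closure_interior convex_triangle) auto
    then show ?thesis using compact_triangle by (simp add: compact_imp_closed)
  qed
  ultimately show ?thesis by auto
qed

text \<open>If g is in the span and within e of \<open>u\<close>, orthogonality gives \<integral>
  u^2 = \<integral> u (u - g) \<le> e \<integral> |u|, and e is arbitrary.\<close>

lemma phi_complete:
  assumes u: "continuous_on triangle u" and 0: "\<And>m n. tri_integral (\<lambda>z. u z * phi m n z) = 0"
  shows "\<forall>z\<in>triangle. u z = 0"
proof -
  have orth: "tri_integral (\<lambda>z. u z * g z) = 0" if "trig_poly g" for g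
    using that
  proof (induction rule: trig_poly.induct)
    case (phi m n)
    show ?case by (rule 0)
  next
    case (add f g)
    then show ?case
      by (simp add: distrib_left tri_integral_add u continuous_on_mult trig_poly_continuous)
  next
    case (scale f c)
    then show ?case using tri_integral_mult_left[of c "\<lambda>z. u z * f z"] by (simp add: mult.left_commute)
  qed
  let ?I = "tri_integral (\<lambda>z. \<bar>u z\<bar>)"
  have cu: "continuous_on triangle (\<lambda>z. u z * u z)" "continuous_on triangle (\<lambda>z. \<bar>u z\<bar>)"
    by (intro continuous_intros u)+
  have z: "tri_integral (\<lambda>z. 0) = 0" by (simp add: tri_integral_def)
  have le: "tri_integral (\<lambda>z. u z * u z) \<le> e * ?I" if e: "e > 0" for e
  proof -
    obtain g where g: "trig_poly g" "\<And>z. z \<in> triangle \<Longrightarrow> \<bar>u z - g z\<bar> < e"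
      using trig_poly_dense[OF u e] by metis
    have c: "continuous_on triangle g" using g(1) by (rule trig_poly_continuous)
    have "tri_integral (\<lambda>z. u z * u z) \<le> tri_integral (\<lambda>z. u z * g z + e * \<bar>u z\<bar>)"
    proof (rule tri_integral_mono)
      fix z assume "z \<in> triangle"
      have "u z * (u z - g z) \<le> \<bar>u z\<bar> * \<bar>u z - g z\<bar>" by (metis abs_ge_self abs_mult)
      also have "\<dots> \<le> \<bar>u z\<bar> * e" using g(2)[OF \<open>z \<in> triangle\<close>] by (intro mult_left_mono) auto
      finally show "u z * u z \<le> u z * g z + e * \<bar>u z\<bar>" by (simp add: algebra_simps)
    qed (intro continuous_intros u c cu)+
    also have "\<dots> = tri_integral (\<lambda>z. u z * g z) + e * ?I"
      by (subst tri_integral_add) (auto intro!: continuous_intros u c cu simp: tri_integral_mult_left)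
    finally show ?thesis by (simp add: orth[OF g(1)])
  qed
  have "?I \<ge> 0" using tri_integral_mono[of "\<lambda>z. 0" "\<lambda>z. \<bar>u z\<bar>"] cu z by simp
  have "tri_integral (\<lambda>z. u z * u z) \<le> 0"
  proof (rule field_le_epsilon)
    fix d :: real assume "d > 0"
    \<comment> \<open>The summand 1 keeps the denominator positive when the integral of |u| is
      0.\<close>
    have "tri_integral (\<lambda>z. u z * u z) \<le> d / (?I + 1) * ?I"
      using \<open>?I \<ge> 0\<close> \<open>d > 0\<close> by (intro le) simp
    also have "\<dots> \<le> d" using \<open>?I \<ge> 0\<close> \<open>d > 0\<close> by (simp add: field_simps)
    finally show "tri_integral (\<lambda>z. u z * u z) \<le> 0 + d" by simp
  qed
  moreover have "tri_integral (\<lambda>z. u z * u z) \<ge> 0"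
    using tri_integral_mono[of "\<lambda>z. 0" "\<lambda>z. u z * u z"] cu z by simp
  ultimately show ?thesis using u by (intro tri_integral_square_eq_0) auto
qed

section \<open>Vanishing on the frames\<close>

text \<open>For continuous functions, membership in the \<open>\<mu>\<close>-eigenspace is equivalent to orthogonality to
  all eigenfunctions with another eigenvalue; in this form it is stable under folding.\<close>

definition eigen_orthogonal :: "real \<Rightarrow> (real \<times> real \<Rightarrow> real) \<Rightarrow> bool" where
  "eigen_orthogonal \<mu> u \<longleftrightarrow> continuous_on triangle u \<and>
    (\<forall>m n. real_of_int (m\<^sup>2 + n\<^sup>2) \<noteq> \<mu> \<longrightarrow> tri_integral (\<lambda>z. u z * phi m n z) = 0)"

lemma eigenfunction_imp_eigen_orthogonal:
  assumes "neumann_eigenfunction \<mu> u"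
  shows "eigen_orthogonal \<mu> u"
proof -
  have u: "continuous_on triangle u" using assms by (simp add: neumann_eigenfunction_def)
  then have "continuous_on triangle (\<lambda>z. u z * phi m n z)" for m n
    by (intro continuous_on_mult continuous_on_phi)
  then show ?thesis
    using eigenfunction_orthogonal[OF assms] u
    by (simp add: eigen_orthogonal_def integral_interior_triangle[symmetric])
qed

text \<open>The reflection t \<mapsto> pi - t multiplies cos(k t) by (-1)^k, and
  \<open>phi m n\<close> is symmetric in its two coordinates.\<close>

lemma phi_R_map: "phi m n (R_map z) = (if even (m + n) then 1 else - 1) * phi m n z"
proof -
  have "cos (real_of_int k * (pi - t)) = (if even k then 1 else - 1) * cos (k * t)" for k t
    by (simp add: right_diff_distrib cos_diff mult.commute[of "real_of_int k" pi])
  then show ?thesis by (auto simp: phi_def R_map_def case_prod_beta)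
qed

lemma phi_F_map: "phi m n (F_map z) = phi (m + n) (m - n) z"
  by (simp add: phi_def F_map_def case_prod_beta distrib_left distrib_right left_diff_distrib
      right_diff_distrib cos_add cos_diff)

lemma R_map_R_map: "R_map (R_map z) = z"
  by (simp add: R_map_def case_prod_beta)

lemma continuous_on_R_map: "continuous_on triangle u \<Longrightarrow> continuous_on triangle (\<lambda>z. u (R_map z))"
  by (rule continuous_on_compose2[of triangle u])
     (auto simp: R_map_triangle, auto simp: R_map_def case_prod_beta intro!: continuous_intros)

lemma tri_integral_R_map_phi:
  assumes "continuous_on triangle u"
  shows "tri_integral (\<lambda>z. u (R_map z) * phi m n z) =
    (if even (m + n) then 1 else - 1) * tri_integral (\<lambda>z. u z * phi m n z)"
proof -
  have "tri_integral (\<lambda>z. u (R_map z) * phi m n z) =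
      tri_integral (\<lambda>z. u (R_map z) * phi m n (R_map (R_map z)))"
    by (simp add: R_map_R_map)
  also have "\<dots> = tri_integral (\<lambda>z. u z * phi m n (R_map z))"
  proof (rule tri_integral_R_map)
    show "continuous_on triangle (\<lambda>z. u z * phi m n (R_map z))"
      by (intro continuous_on_mult assms continuous_on_R_map continuous_on_phi)
  qed
  also have "\<dots> = tri_integral (\<lambda>z. (if even (m + n) then 1 else - 1) * (u z * phi m n z))"
    by (simp add: phi_R_map)
  finally show ?thesis by (simp only: tri_integral_mult_left)
qed

text \<open>Against \<open>phi m n\<close>, the function u \<circ> R - s u integrates to ((-1)^(m+n)
  - s) times the integral of u \<open>phi m n\<close>. If m^2 + n^2 = l, the first factor is 0
  because m + n and l have the same parity; otherwise the integral is 0. Completeness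
  concludes.\<close>

lemma eigen_orthogonal_parity:
  assumes u: "eigen_orthogonal (real_of_int l) u" and z: "z \<in> triangle"
  shows "u (R_map z) = (if even l then 1 else - 1) * u z"
proof -
  define s :: real where "s = (if even l then 1 else - 1)"
  have c: "continuous_on triangle u" using u by (simp add: eigen_orthogonal_def)
  have cv: "continuous_on triangle (\<lambda>z. u (R_map z) + (- s) * u z)"
    by (intro continuous_on_add continuous_on_mult continuous_on_const c continuous_on_R_map)
  have "tri_integral (\<lambda>z. (u (R_map z) + (- s) * u z) * phi m n z) = 0" for m n
  proof -
    have "tri_integral (\<lambda>z. (u (R_map z) + (- s) * u z) * phi m n z) =
        tri_integral (\<lambda>z. u (R_map z) * phi m n z + (- s) * (u z * phi m n z))"
      by (simp add: algebra_simps)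
    also have "\<dots> = tri_integral (\<lambda>z. u (R_map z) * phi m n z) + tri_integral (\<lambda>z. (- s) * (u z * phi m n z))"
      by (intro tri_integral_add continuous_on_mult continuous_on_const continuous_on_R_map c continuous_on_phi)
    also have "\<dots> = ((if even (m + n) then 1 else - 1) - s) * tri_integral (\<lambda>z. u z * phi m n z)"
      by (simp only: tri_integral_R_map_phi[OF c] tri_integral_mult_left) (simp add: algebra_simps)
    also have "\<dots> = 0"
    proof (cases "m\<^sup>2 + n\<^sup>2 = l")
      case True
      then have "even (m + n) \<longleftrightarrow> even l" by auto
      then show ?thesis by (simp add: s_def)
    next
      case False
      then show ?thesis using u unfolding eigen_orthogonal_def by (simp del: of_int_add of_int_power)
    qed
    finally show ?thesis .
  qed
  from phi_complete[OF cv this] z show ?thesis by (auto simp: s_def)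
qed

definition F_inv :: "real \<times> real \<Rightarrow> real \<times> real" where
  "F_inv z = ((fst z + snd z) / 2, (fst z - snd z) / 2)"

lemma F_inv_F_map: "F_inv (F_map z) = z"
  by (simp add: F_inv_def F_map_def case_prod_beta)

text \<open>The even eigenvalue makes \<open>u\<close> invariant under \<open>R_map\<close>, and
  \<open>phi (m + n) (m - n)\<close> is invariant because its indices add up to 2m. So folding
  applies to their product, and the indices m + n, m - n belong to the eigenvalue 2 (m^2 +
  n^2).\<close>

lemma eigen_orthogonal_fold:
  assumes u: "eigen_orthogonal (real_of_int (2 * l)) u"
  shows "eigen_orthogonal (real_of_int l) (\<lambda>z. u (F_inv z))"
  unfolding eigen_orthogonal_def
proof (intro conjI allI impI)
  have c: "continuous_on triangle u" using u by (simp add: eigen_orthogonal_def)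
  show w: "continuous_on triangle (\<lambda>z. u (F_inv z))"
    by (rule continuous_on_compose2[OF c])
       (auto simp: F_inv_def triangle_eq intro!: continuous_intros)
  fix m n :: int assume ne: "real_of_int (m\<^sup>2 + n\<^sup>2) \<noteq> real_of_int l"
  then have "m\<^sup>2 + n\<^sup>2 \<noteq> l" by blast
  moreover have "(m + n)\<^sup>2 + (m - n)\<^sup>2 = 2 * (m\<^sup>2 + n\<^sup>2)"
    by (simp add: power2_eq_square algebra_simps)
  ultimately have "(m + n)\<^sup>2 + (m - n)\<^sup>2 \<noteq> 2 * l"
    by (metis mult_left_cancel zero_neq_numeral)
  then have "tri_integral (\<lambda>z. u z * phi (m + n) (m - n) z) = 0"
    using u unfolding eigen_orthogonal_def by (simp only: of_int_eq_iff) blast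
  moreover have "tri_integral (\<lambda>z. u (F_inv z) * phi m n z) = tri_integral (\<lambda>z. u z * phi (m + n) (m - n) z)"
  proof (rule tri_integral_fold)
    show "u (R_map z) * phi (m + n) (m - n) (R_map z) = u z * phi (m + n) (m - n) z" if "z \<in> triangle" for z
      using eigen_orthogonal_parity[OF u that] by (simp add: phi_R_map)
    show "u z * phi (m + n) (m - n) z = u (F_inv (F_map z)) * phi m n (F_map z)" for z
      by (simp add: F_inv_F_map phi_F_map)
  qed (intro continuous_on_mult w c continuous_on_phi)+
  ultimately show "tri_integral (\<lambda>z. u (F_inv z) * phi m n z) = 0" by simp
qed

text \<open>Induction with \<open>u\<close> arbitrary, since the hypothesis for \<open>k\<close> is
  applied to the folded function \<open>\<lambda>z. u (F_inv z)\<close>. On the 0-frame, whose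
  points \<open>R_map\<close> fixes, odd parity gives u = -u.\<close>

lemma eigen_orthogonal_vanishes_on_frame:
  assumes "odd l" "eigen_orthogonal (real_of_int (2 ^ k * l)) u" "z \<in> frame k"
  shows "u z = 0"
  using assms(2,3)
proof (induction k arbitrary: u z)
  case 0
  then have "z \<in> triangle" "R_map z = z"
    by (auto simp: frame_def L_set_def R_map_def)
  moreover have "eigen_orthogonal (real_of_int l) u" using 0 by simp
  ultimately show ?case using eigen_orthogonal_parity[of l u z] \<open>odd l\<close> by simp
next
  case (Suc k)
  have u: "eigen_orthogonal (real_of_int (2 * (2 ^ k * l))) u" using Suc.prems(1) by (simp add: mult.assoc)
  have w: "u z = 0" if "F_map z \<in> frame k" for z
    using Suc.IH[OF eigen_orthogonal_fold[OF u] that] by (simp add: F_inv_F_map)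
  have "z \<in> unfold (frame k)" using Suc.prems(2) by (simp add: frame_def)
  then consider "F_map z \<in> frame k" | "z \<in> triangle" "F_map (R_map z) \<in> frame k"
    by (auto simp: unfold_def)
  then show ?case
  proof cases
    case 1
    then show ?thesis by (rule w)
  next
    case 2
    \<comment> \<open>The eigenvalue carries a factor 2, so reflection moves the point into the half
      triangle without changing the value of \<open>u\<close>.\<close>
    have "u z = u (R_map z)" using eigen_orthogonal_parity[OF u 2(1)] by simp
    also have "\<dots> = 0" using 2(2) by (rule w)
    finally show ?thesis .
  qed
qed

theorem proposition2p8:
  fixes k :: nat and lam0 :: real and u :: "real \<times> real \<Rightarrow> real"
  assumes "lam0 \<in> sigma_odd"
    and "neumann_eigenfunction (2 ^ k * lam0) u"
  shows "\<forall>z\<in>frame k. u z = 0"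
proof
  fix z assume z: "z \<in> frame k"
  obtain m n :: nat where mn: "lam0 = eig m n" "m mod 2 \<noteq> n mod 2"
    using assms(1) by (auto simp: sigma_odd_def O_index_def)
  define l where "l = int (m\<^sup>2 + n\<^sup>2)"
  have "odd m \<noteq> odd n" using mn(2) by presburger
  then have "odd l" by (auto simp: l_def)
  moreover have "2 ^ k * lam0 = real_of_int (2 ^ k * l)" by (simp add: mn(1) eig_def l_def)
  ultimately show "u z = 0"
    using eigen_orthogonal_vanishes_on_frame[OF _ _ z] eigenfunction_imp_eigen_orthogonal[OF assms(2)]
    by simp
qed

end
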